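(* Every Jordan algebra $\mathcal{A}$ of dimension three over $\mathbb{C}$ is isomorphic to the Jordan algebra $\mathbb{C}\{U,X,Y\}$ with basis $U,X,Y$ and unit $U$, where the product is given by one of the following: 1(a): $X^{\bullet2}=X$, $Y^{\bullet2}=Y$ and $X\bullet Y=0$, when $\mathcal{A}\cong\mathbb{C}\times\mathbb{C}\times\mathbb{C}$; 1(b): $X^{\bullet2}=U$, $Y^{\bullet2}=U$ and $X\bullet Y=0$, when $\mathcal{A}$ is isomorphic to the spin factor $\mathbb{C}\times\mathbb{C}^2$; 2(a): $X^{\bullet2}=X$, $Y^{\bullet2}=0$ and $X\bullet Y=0$, or 2(b): $X^{\bullet2}=X$, $Y^{\bullet2}=0$ and $X\bullet Y=Y/2$, when $\mathcal{A}/\operatorname{rad}\mathcal{A}\cong\mathbb{C}\times\mathbb{C}$; or 3(a): $X^{\bullet2}=Y$, $Y^{\bullet2}=0$ and $X\bullet Y=0$, or 3(b): $X^{\bullet2}=0$, $Y^{\bullet2}=0$ and $X\bullet Y=0$, when $\mathcal{A}/\operatorname{rad}\mathcal{A}\cong\mathbb{C}$.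
   Context: A Jordan algebra over $\mathbb{C}$ is a $\mathbb{C}$-vector space with a commutative bilinear product $\bullet$, having a unit, and satisfying $X^{\bullet2}\bullet(X\bullet Y)=X\bullet(X^{\bullet2}\bullet Y)$ for all $X,Y$, where $X^{\bullet2}=X\bullet X$. The radical of $\mathcal{A}$ is the ideal $\operatorname{rad}\mathcal{A}=\{X\in\mathcal{A}\mid X\bullet Y\text{ is nilpotent for all }Y\in\mathcal{A}\}$. The algebras $\mathbb{C}$, $\mathbb{C}\times\mathbb{C}$ and $\mathbb{C}\times\mathbb{C}\times\mathbb{C}$ carry the usual componentwise multiplication. For $d\ge2$ the spin factor $\mathbb{C}\times\mathbb{C}^d$ has product $(\lambda,a)\bullet(\mu,b)=(\lambda\mu+a^\top b,\lambda b+\mu a)$ and unit $(1,0)$. *)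

theory Defs
  imports "HOL-Algebra.QuotRing" "Jordan_Normal_Form.VS_Connect"
begin

text \<open>
  Complex algebras are records of type \<^typ>\<open>(complex, 'a) module\<close>. The record carries an addition,
  a scalar multiplication, a product and a distinguished element \<open>\<one>\<close>; no law for the product
  (in particular no associativity) is built into the record.
  The field of complex numbers, as a record, is \<^term>\<open>class_ring :: complex ring\<close>.
\<close>

locale jordan_algebra = vectorspace "class_ring :: complex ring" A
  for A :: "(complex, 'a) module" (structure) +
  assumes mult_closed: "\<lbrakk>x \<in> carrier A; y \<in> carrier A\<rbrakk> \<Longrightarrow> x \<otimes> y \<in> carrier A"
    and mult_add_left: "\<lbrakk>x \<in> carrier A; y \<in> carrier A; z \<in> carrier A\<rbrakk>
          \<Longrightarrow> (x \<oplus> y) \<otimes> z = x \<otimes> z \<oplus> y \<otimes> z"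
    and mult_smult_left: "\<lbrakk>x \<in> carrier A; y \<in> carrier A\<rbrakk> \<Longrightarrow> (c \<odot>\<^bsub>A\<^esub> x) \<otimes> y = c \<odot>\<^bsub>A\<^esub> (x \<otimes> y)"
    and mult_commute: "\<lbrakk>x \<in> carrier A; y \<in> carrier A\<rbrakk> \<Longrightarrow> x \<otimes> y = y \<otimes> x"
    and one_in_carrier: "\<one> \<in> carrier A"
    and one_mult: "x \<in> carrier A \<Longrightarrow> \<one> \<otimes> x = x"
    and jordan_identity: "\<lbrakk>x \<in> carrier A; y \<in> carrier A\<rbrakk>
          \<Longrightarrow> (x \<otimes> x) \<otimes> (x \<otimes> y) = x \<otimes> ((x \<otimes> x) \<otimes> y)"

text \<open>
  \<^const>\<open>ring_iso\<close> consists of the bijections between the carriers that respect sum, product and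
  \<open>\<one>\<close>; it does not presuppose that its arguments are associative rings.
\<close>

definition alg_isomorphic :: "(complex, 'a) module \<Rightarrow> (complex, 'b) module \<Rightarrow> bool"
    (infix \<open>\<cong>\<^sub>J\<close> 50) where
  "A \<cong>\<^sub>J B \<longleftrightarrow>
     (\<exists>h \<in> ring_iso A B. \<forall>c. \<forall>x \<in> carrier A. h (c \<odot>\<^bsub>A\<^esub> x) = c \<odot>\<^bsub>B\<^esub> h x)"

text \<open>The power \<^term>\<open>x [^]\<^bsub>A\<^esub> (n :: nat)\<close> is bracketed to the left, \<open>(\<dots>(\<one> \<otimes> x) \<otimes> \<dots>) \<otimes> x\<close>.\<close>

definition nilpotent :: "(complex, 'a) module \<Rightarrow> 'a \<Rightarrow> bool" where
  "nilpotent A x \<longleftrightarrow> (\<exists>n::nat. n > 0 \<and> x [^]\<^bsub>A\<^esub> n = \<zero>\<^bsub>A\<^esub>)"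

definition rad :: "(complex, 'a) module \<Rightarrow> 'a set" where
  "rad A = {x \<in> carrier A. \<forall>y \<in> carrier A. nilpotent A (x \<otimes>\<^bsub>A\<^esub> y)}"

text \<open>
  The quotient by an ideal: the library's quotient of cosets \<^term>\<open>A Quot I\<close>, whose definition
  applies to any product, with \<open>c \<odot> (I + a) = I + c \<odot> a\<close>.
\<close>

definition quot_algebra :: "(complex, 'a) module \<Rightarrow> 'a set \<Rightarrow> (complex, 'a set) module" where
  "quot_algebra A I = ring.extend (A Quot I)
     \<lparr> smult = (\<lambda>c S. \<Union>a\<in>S. I +>\<^bsub>A\<^esub> (c \<odot>\<^bsub>A\<^esub> a)) \<rparr>"

definition complex_algebra :: "(complex, complex) module" where
  "complex_algebra =
     \<lparr> carrier = UNIV, mult = (*), one = 1, zero = 0, add = (+), smult = (*) \<rparr>"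

definition prod_algebra ::
    "(complex, 'a) module \<Rightarrow> (complex, 'b) module \<Rightarrow> (complex, 'a \<times> 'b) module"
    (infixr \<open>\<times>\<^sub>J\<close> 80) where
  "A \<times>\<^sub>J B =
     \<lparr> carrier = carrier A \<times> carrier B,
       mult = (\<lambda>(a, b) (a', b'). (a \<otimes>\<^bsub>A\<^esub> a', b \<otimes>\<^bsub>B\<^esub> b')),
       one = (\<one>\<^bsub>A\<^esub>, \<one>\<^bsub>B\<^esub>),
       zero = (\<zero>\<^bsub>A\<^esub>, \<zero>\<^bsub>B\<^esub>),
       add = (\<lambda>(a, b) (a', b'). (a \<oplus>\<^bsub>A\<^esub> a', b \<oplus>\<^bsub>B\<^esub> b')),
       smult = (\<lambda>c (a, b). (c \<odot>\<^bsub>A\<^esub> a, c \<odot>\<^bsub>B\<^esub> b)) \<rparr>"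

text \<open>
  The pairing \<open>a \<bullet> b\<close> of complex vectors is the bilinear form \<open>\<Sum>i. a\<^sub>i b\<^sub>i\<close>, without conjugation.
\<close>

definition spin_factor :: "nat \<Rightarrow> (complex, complex \<times> complex vec) module" where
  "spin_factor d =
     \<lparr> carrier = UNIV \<times> carrier_vec d,
       mult = (\<lambda>(l, a) (m, b). (l * m + a \<bullet> b, l \<cdot>\<^sub>v b + m \<cdot>\<^sub>v a)),
       one = (1, 0\<^sub>v d),
       zero = (0, 0\<^sub>v d),
       add = (\<lambda>(l, a) (m, b). (l + m, a + b)),
       smult = (\<lambda>c (l, a). (c * l, c \<cdot>\<^sub>v a)) \<rparr>"

text \<open>
  The algebra \<open>\<complex>{U, X, Y}\<close>: the vector space \<open>\<complex>\<^sup>3\<close> with standard basis \<open>U, X, Y\<close> and the commutative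
  bilinear product with unit \<open>U\<close> for which \<open>X \<otimes> X = p\<close>, \<open>Y \<otimes> Y = q\<close> and \<open>X \<otimes> Y = r\<close>.
\<close>

abbreviation U_vec :: "complex vec" where "U_vec \<equiv> unit_vec 3 0"
abbreviation X_vec :: "complex vec" where "X_vec \<equiv> unit_vec 3 1"
abbreviation Y_vec :: "complex vec" where "Y_vec \<equiv> unit_vec 3 2"

definition UXY_algebra ::
    "complex vec \<Rightarrow> complex vec \<Rightarrow> complex vec \<Rightarrow> (complex, complex vec) module" where
  "UXY_algebra p q r = (module_vec TYPE(complex) 3)
     \<lparr> one := U_vec,
       mult := (\<lambda>v w.
           (v $ 0 * w $ 0) \<cdot>\<^sub>v U_vec
         + (v $ 0 * w $ 1 + v $ 1 * w $ 0) \<cdot>\<^sub>v X_vec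
         + (v $ 0 * w $ 2 + v $ 2 * w $ 0) \<cdot>\<^sub>v Y_vec
         + (v $ 1 * w $ 1) \<cdot>\<^sub>v p
         + (v $ 2 * w $ 2) \<cdot>\<^sub>v q
         + (v $ 1 * w $ 2 + v $ 2 * w $ 1) \<cdot>\<^sub>v r) \<rparr>"

lemma UXY_algebra_products:
  fixes p q r :: "complex vec"
  assumes "p \<in> carrier_vec 3" "q \<in> carrier_vec 3" "r \<in> carrier_vec 3"
  defines "B \<equiv> UXY_algebra p q r"
  shows "X_vec \<otimes>\<^bsub>B\<^esub> X_vec = p" "Y_vec \<otimes>\<^bsub>B\<^esub> Y_vec = q"
    "X_vec \<otimes>\<^bsub>B\<^esub> Y_vec = r" "Y_vec \<otimes>\<^bsub>B\<^esub> X_vec = r"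
    "\<And>v. v \<in> carrier B \<Longrightarrow> U_vec \<otimes>\<^bsub>B\<^esub> v = v"
  using assms
  by (auto simp: UXY_algebra_def module_vec_def unit_vec_def less_Suc_eq numeral_3_eq_3
      numeral_2_eq_2 intro!: eq_vecI)

definition algebra_1a where "algebra_1a = UXY_algebra X_vec Y_vec (0\<^sub>v 3)"
definition algebra_1b where "algebra_1b = UXY_algebra U_vec U_vec (0\<^sub>v 3)"
definition algebra_2a where "algebra_2a = UXY_algebra X_vec (0\<^sub>v 3) (0\<^sub>v 3)"
definition algebra_2b where "algebra_2b = UXY_algebra X_vec (0\<^sub>v 3) ((1/2) \<cdot>\<^sub>v Y_vec)"
definition algebra_3a where "algebra_3a = UXY_algebra Y_vec (0\<^sub>v 3) (0\<^sub>v 3)"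
definition algebra_3b where "algebra_3b = UXY_algebra (0\<^sub>v 3) (0\<^sub>v 3) (0\<^sub>v 3)"

end

theory Submission
  imports Defs "HOL-Computational_Algebra.Fundamental_Theorem_Algebra"
begin

text \<open>
  The classification rests on a dichotomy for the unital algebra \<open>A\<close> of dimension three.

  Suppose first that some \<open>x\<close> generates \<open>A\<close>, so that \<open>\<one>, x, x\<^sup>2\<close> is a basis. The Jordan identity with
  both arguments equal to \<open>x\<close> says \<open>x\<^sup>2 \<otimes> x\<^sup>2 = x \<otimes> x\<^sup>3\<close>, and this single equation determines the
  product: \<open>A\<close> is \<open>\<complex>[t]/(f)\<close> for the monic cubic \<open>f\<close> that expresses \<open>x\<^sup>3\<close> in the basis. The cubic
  splits over \<open>\<complex>\<close>. Three distinct roots give \<open>\<complex> \<times> \<complex> \<times> \<complex>\<close>, a double root gives \<open>algebra_2a\<close>,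
  and a triple root gives \<open>algebra_3a\<close> (\<open>generator_classification\<close>).

  Suppose instead that every \<open>x\<close> satisfies a quadratic equation. Applied to \<open>x\<close>, \<open>y\<close>, \<open>x + y\<close> and
  \<open>x - y\<close> for a basis \<open>\<one>, x, y\<close>, this forces, after translating \<open>x\<close> and \<open>y\<close> by multiples of \<open>\<one>\<close>,
  all of \<open>x\<^sup>2\<close>, \<open>y\<^sup>2\<close> and \<open>x \<otimes> y\<close> to be scalars (\<open>quadratic_form_shape\<close>). So \<open>A\<close> is the algebra of a
  symmetric bilinear form on \<open>\<complex>\<^sup>2\<close>, and a form over \<open>\<complex>\<close> is determined by its rank: rank 2, 1 and 0
  give \<open>algebra_1b\<close>, \<open>algebra_2b\<close> and \<open>algebra_3b\<close> (\<open>form_classification\<close>). In rank 1 a vector \<open>x\<close> with \<open>x\<^sup>2 = \<one>\<close> is traded for the idempotent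
  \<open>(\<one> + x)/2\<close>.

  For the radical, each of the six algebras is mapped onto a known algebra \<open>T\<close> with zero radical by a
  homomorphism whose kernel consists of nilpotent elements. The kernel of such a map is exactly the
  radical, and hence \<open>A/rad A \<cong> T\<close> (\<open>radical_epimorphism\<close>). Here \<open>T\<close> is \<open>\<complex> \<times> \<complex> \<times> \<complex>\<close> for
  \<open>algebra_1a\<close>, the spin factor for \<open>algebra_1b\<close>, \<open>\<complex> \<times> \<complex>\<close> for \<open>algebra_2a\<close> and \<open>algebra_2b\<close>, and
  \<open>\<complex>\<close> for the remaining two. These four targets have eight, infinitely many, four and two idempotents
  respectively. So no two of them are isomorphic, and the quotient determines to which of the four
  groups \<open>A\<close> belongs.
\<close>

section \<open>Bases that begin with the unit\<close>

context jordan_algebra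
begin

lemma mult_add_right:
  "\<lbrakk>x \<in> carrier A; y \<in> carrier A; z \<in> carrier A\<rbrakk> \<Longrightarrow> x \<otimes> (y \<oplus> z) = x \<otimes> y \<oplus> x \<otimes> z"
  by (metis mult_add_left mult_commute M.add.m_closed)

lemma mult_smult_right:
  "\<lbrakk>x \<in> carrier A; y \<in> carrier A\<rbrakk> \<Longrightarrow> x \<otimes> (c \<odot>\<^bsub>A\<^esub> y) = c \<odot>\<^bsub>A\<^esub> (x \<otimes> y)"
  using mult_smult_left[of y x c] mult_commute[of x y] mult_commute[of x "c \<odot>\<^bsub>A\<^esub> y"] by auto

definition comb :: "'a \<Rightarrow> 'a \<Rightarrow> complex \<Rightarrow> complex \<Rightarrow> complex \<Rightarrow> 'a" where
  "comb x y a b c = a \<odot>\<^bsub>A\<^esub> \<one> \<oplus> b \<odot>\<^bsub>A\<^esub> x \<oplus> c \<odot>\<^bsub>A\<^esub> y"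

lemma smult_in_carrier [simp]: "x \<in> carrier A \<Longrightarrow> c \<odot>\<^bsub>A\<^esub> x \<in> carrier A"
  using smult_closed by simp

lemma smult_add_scalars: "x \<in> carrier A \<Longrightarrow> (a + b) \<odot>\<^bsub>A\<^esub> x = a \<odot>\<^bsub>A\<^esub> x \<oplus> b \<odot>\<^bsub>A\<^esub> x"
  using smult_l_distr[of a b x] by simp

lemma smult_mult_scalars: "x \<in> carrier A \<Longrightarrow> (a * b) \<odot>\<^bsub>A\<^esub> x = a \<odot>\<^bsub>A\<^esub> (b \<odot>\<^bsub>A\<^esub> x)"
  using smult_assoc1[of a b x] by simp

lemma smult_add_vectors:
  "\<lbrakk>x \<in> carrier A; y \<in> carrier A\<rbrakk> \<Longrightarrow> a \<odot>\<^bsub>A\<^esub> (x \<oplus> y) = a \<odot>\<^bsub>A\<^esub> x \<oplus> a \<odot>\<^bsub>A\<^esub> y"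
  using smult_r_distr[of a x y] by simp

lemma zero_smult: "x \<in> carrier A \<Longrightarrow> 0 \<odot>\<^bsub>A\<^esub> x = \<zero>"
  using lmult_0[of x] by simp

lemma one_smult: "x \<in> carrier A \<Longrightarrow> 1 \<odot>\<^bsub>A\<^esub> x = x"
  using smult_one[of x] by simp

lemmas smult_scalars = smult_add_scalars smult_mult_scalars smult_add_vectors zero_smult one_smult

lemma comb_closed [simp]: "\<lbrakk>x \<in> carrier A; y \<in> carrier A\<rbrakk> \<Longrightarrow> comb x y a b c \<in> carrier A"
  by (simp add: comb_def one_in_carrier)

lemma comb_add:
  "\<lbrakk>x \<in> carrier A; y \<in> carrier A\<rbrakk>
    \<Longrightarrow> comb x y a b c \<oplus> comb x y a' b' c' = comb x y (a + a') (b + b') (c + c')"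
  by (simp add: comb_def one_in_carrier smult_scalars M.a_ac)

lemma comb_smult:
  "\<lbrakk>x \<in> carrier A; y \<in> carrier A\<rbrakk> \<Longrightarrow> k \<odot>\<^bsub>A\<^esub> comb x y a b c = comb x y (k * a) (k * b) (k * c)"
  by (simp add: comb_def one_in_carrier smult_scalars)

lemma comb_units:
  assumes "x \<in> carrier A" "y \<in> carrier A"
  shows "comb x y 1 0 0 = \<one>" "comb x y 0 1 0 = x" "comb x y 0 0 1 = y" "comb x y 0 0 0 = \<zero>"
  using assms by (simp_all add: comb_def one_in_carrier smult_scalars)

text \<open>
  The structure constants of \<open>x \<otimes> x\<close>, \<open>y \<otimes> y\<close> and \<open>x \<otimes> y\<close> turn every product into arithmetic on
  coordinates, and so an identity in the algebra into three identities of complex numbers.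
\<close>

lemma comb_mult:
  assumes xy: "x \<in> carrier A" "y \<in> carrier A"
    and xx: "x \<otimes> x = comb x y p0 p1 p2" and yy: "y \<otimes> y = comb x y q0 q1 q2"
    and xy': "x \<otimes> y = comb x y r0 r1 r2"
  shows "comb x y a b c \<otimes> comb x y a' b' c' = comb x y
     (a * a' + b * b' * p0 + c * c' * q0 + (b * c' + c * b') * r0)
     (a * b' + b * a' + b * b' * p1 + c * c' * q1 + (b * c' + c * b') * r1)
     (a * c' + c * a' + b * b' * p2 + c * c' * q2 + (b * c' + c * b') * r2)"
proof -
  let ?w = "comb x y a' b' c'"
  have expand: "comb x y a b c \<otimes> v = a \<odot>\<^bsub>A\<^esub> v \<oplus> b \<odot>\<^bsub>A\<^esub> (x \<otimes> v) \<oplus> c \<odot>\<^bsub>A\<^esub> (y \<otimes> v)"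
    if "v \<in> carrier A" for v
    using that xy by (simp add: comb_def mult_add_left mult_smult_left one_in_carrier one_mult mult_closed)
  have yx: "y \<otimes> x = comb x y r0 r1 r2" using xy xy' mult_commute by simp
  have expand': "v \<otimes> ?w = a' \<odot>\<^bsub>A\<^esub> v \<oplus> b' \<odot>\<^bsub>A\<^esub> (v \<otimes> x) \<oplus> c' \<odot>\<^bsub>A\<^esub> (v \<otimes> y)"
    if "v \<in> carrier A" for v
    using that xy mult_commute[OF that one_in_carrier]
    by (simp add: comb_def mult_add_right mult_smult_right one_in_carrier one_mult mult_closed)
  have "x \<otimes> ?w = a' \<odot>\<^bsub>A\<^esub> comb x y 0 1 0 \<oplus> b' \<odot>\<^bsub>A\<^esub> comb x y p0 p1 p2 \<oplus> c' \<odot>\<^bsub>A\<^esub> comb x y r0 r1 r2"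
    using expand'[of x] xy xx xy' comb_units(2)[OF xy] by simp
  moreover have "y \<otimes> ?w = a' \<odot>\<^bsub>A\<^esub> comb x y 0 0 1 \<oplus> b' \<odot>\<^bsub>A\<^esub> comb x y r0 r1 r2 \<oplus> c' \<odot>\<^bsub>A\<^esub> comb x y q0 q1 q2"
    using expand'[of y] xy yy yx comb_units(3)[OF xy] by simp
  ultimately show ?thesis
    using xy by (simp add: expand comb_smult comb_add algebra_simps)
qed

lemma comb_comb:
  assumes "x \<in> carrier A" "y \<in> carrier A"
  shows "comb (comb x y a b c) (comb x y a' b' c') k l m =
    comb x y (k + l * a + m * a') (l * b + m * b') (l * c + m * c')"
proof -
  have "comb (comb x y a b c) (comb x y a' b' c') k l m =
      k \<odot>\<^bsub>A\<^esub> comb x y 1 0 0 \<oplus> l \<odot>\<^bsub>A\<^esub> comb x y a b c \<oplus> m \<odot>\<^bsub>A\<^esub> comb x y a' b' c'"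
    using comb_units(1)[OF assms] by (simp add: comb_def)
  then show ?thesis using assms by (simp add: comb_smult comb_add)
qed

text \<open>
  The unit is always taken as the first basis vector, so a basis is given by its other two members.
  Bijectivity of the coordinate map expresses independence and spanning at once.
\<close>

definition frame :: "'a \<Rightarrow> 'a \<Rightarrow> bool" where
  "frame x y \<longleftrightarrow> x \<in> carrier A \<and> y \<in> carrier A \<and>
     bij_betw (\<lambda>(a, b, c). comb x y a b c) UNIV (carrier A)"

lemma frame_carrier: "frame x y \<Longrightarrow> x \<in> carrier A" "frame x y \<Longrightarrow> y \<in> carrier A"
  by (auto simp: frame_def)

lemma frame_eq_iff:
  assumes "frame x y"
  shows "comb x y a b c = comb x y a' b' c' \<longleftrightarrow> a = a' \<and> b = b' \<and> c = c'"
  using assms by (auto simp: frame_def bij_betw_def inj_on_def)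

lemma frame_coords:
  assumes "frame x y" "z \<in> carrier A"
  obtains a b c where "z = comb x y a b c"
proof -
  have "z \<in> (\<lambda>(a, b, c). comb x y a b c) ` UNIV"
    using assms by (simp add: frame_def bij_betw_def)
  then show thesis using that by auto
qed

text \<open>
  Adding multiples of \<open>\<one>\<close> does not affect independence modulo \<open>\<one>\<close>, so only the \<open>2 \<times> 2\<close> determinant
  of the remaining coordinates matters.
\<close>

lemma frame_change:
  assumes fr: "frame x y" and det: "b * c' - c * b' \<noteq> 0"
  shows "frame (comb x y a b c) (comb x y a' b' c')"
proof -
  let ?d = "b * c' - c * b'" and ?x = "comb x y a b c" and ?y = "comb x y a' b' c'"
  note xy = frame_carrier[OF fr]
  note subst = comb_comb[OF xy]
  have inj: "k = k' \<and> l = l' \<and> m = m'" if "comb ?x ?y k l m = comb ?x ?y k' l' m'" for k l m k' l' m'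
  proof -
    from that have e: "k + l * a + m * a' = k' + l' * a + m' * a'" "l * b + m * b' = l' * b + m' * b'"
      "l * c + m * c' = l' * c + m' * c'"
      unfolding subst frame_eq_iff[OF fr] by auto
    have "(l - l') * ?d = c' * (l * b + m * b' - (l' * b + m' * b')) - b' * (l * c + m * c' - (l' * c + m' * c'))"
      "(m - m') * ?d = b * (l * c + m * c' - (l' * c + m' * c')) - c * (l * b + m * b' - (l' * b + m' * b'))"
      by (simp_all add: algebra_simps)
    then have "(l - l') * ?d = 0" "(m - m') * ?d = 0" by (simp_all add: e)
    then show ?thesis using det e(1) by simp
  qed
  have surj: "\<exists>k l m. z = comb ?x ?y k l m" if z_in: "z \<in> carrier A" for z
  proof -
    obtain s t u where z: "z = comb x y s t u" using frame_coords[OF fr z_in] .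
    \<comment> \<open>Cramer's rule for the two coordinates beside that of the unit.\<close>
    define l where "l = (t * c' - u * b') / ?d"
    define m where "m = (b * u - c * t) / ?d"
    have "l * b + m * b' = t * ?d / ?d" "l * c + m * c' = u * ?d / ?d"
      unfolding l_def m_def times_divide_eq_left add_divide_distrib[symmetric]
      by (simp_all add: algebra_simps)
    then have "l * b + m * b' = t" "l * c + m * c' = u" using det by simp_all
    then have "z = comb ?x ?y (s - l * a - m * a') l m" by (simp add: subst z)
    then show ?thesis by blast
  qed
  have "inj (\<lambda>(k, l, m). comb ?x ?y k l m)"
    using inj by (auto intro!: injI)
  moreover have "(\<lambda>(k, l, m). comb ?x ?y k l m) ` UNIV = carrier A"
  proof (intro equalityI subsetI)
    fix z assume "z \<in> carrier A"
    then obtain k l m where "z = comb ?x ?y k l m" using surj by blast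
    then show "z \<in> (\<lambda>(k, l, m). comb ?x ?y k l m) ` UNIV"
      by (intro image_eqI[of _ _ "(k, l, m)"]) auto
  qed (use xy in auto)
  ultimately show ?thesis using xy by (simp add: frame_def bij_betw_def)
qed

text \<open>
  The unit is nonzero in a nonzero algebra, and the replacement theorem completes it to a basis.
\<close>

lemma frame_exists:
  assumes fd: fin_dim and d3: "dim = 3"
  obtains x y where "frame x y"
proof -
  obtain B where B: "finite B" "basis B" using finite_basis_exists[OF fd] by auto
  have cB: "card B = 3" using dim_basis[OF B] d3 by simp
  have BA: "B \<subseteq> carrier A" "gen_set B" "lin_indpt B" using B by (auto simp: basis_def)
  have one_nz: "\<one> \<noteq> \<zero>"
  proof
    assume "\<one> = \<zero>"
    obtain b where b: "b \<in> B" using cB by fastforce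
    then have "b = \<zero>"
      using one_mult[of b] mult_smult_left[of \<one> b 0] BA \<open>\<one> = \<zero>\<close>
      by (auto simp: zero_smult one_in_carrier)
    then show False using vs_zero_lin_dep[OF BA(1,3)] b by simp
  qed
  have li1: "lin_indpt {\<one>}"
    by (metis emptyE empty_subsetI insert_is_Un lin_dep_def lin_dep_iff_in_span one_nz
        one_in_carrier span_empty singletonD subset_empty Un_commute)
  obtain C where C: "finite C" "C \<subseteq> carrier A" "C \<inter> {\<one>} = {}"
      "int (card C) \<le> int (card B) - int (card {\<one>})" "span ({\<one>} \<union> C) = span B"
    using replacement[OF _ B(1) BA(1) li1] BA(2) one_in_carrier by auto
  have bas: "basis (insert \<one> C)"
    using C BA(2) one_in_carrier cB d3 by (intro dim_gen_is_basis) (auto simp: card_insert_if)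
  then have "card (insert \<one> C) = 3" using dim_basis[of "insert \<one> C"] C(1) d3 by simp
  then have "card C = 2" using C by simp
  then obtain x y where xy: "C = {x, y}" "x \<noteq> y" by (auto simp: card_2_iff)
  have car: "x \<in> carrier A" "y \<in> carrier A" and ne: "x \<noteq> \<one>" "y \<noteq> \<one>" using C xy by auto
  have lc: "lincomb f {\<one>, x, y} = comb x y (f \<one>) (f x) (f y)" for f
  proof -
    have "lincomb f {y} = f y \<odot>\<^bsub>A\<^esub> y" using lincomb_insert[of "{}" f y] car by (simp add: lincomb_def)
    moreover have "lincomb f {x, y} = f x \<odot>\<^bsub>A\<^esub> x \<oplus> lincomb f {y}"
      using lincomb_insert[of "{y}" f x] car xy by simp
    moreover have "lincomb f {\<one>, x, y} = f \<one> \<odot>\<^bsub>A\<^esub> \<one> \<oplus> lincomb f {x, y}"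
      using lincomb_insert[of "{x, y}" f \<one>] car ne one_in_carrier by simp
    ultimately show ?thesis using car one_in_carrier by (simp add: comb_def M.a_assoc)
  qed
  have uniq: "\<exists>!f. f \<in> {\<one>, x, y} \<rightarrow>\<^sub>E UNIV \<and> comb x y (f \<one>) (f x) (f y) = v" if "v \<in> carrier A" for v
    using basis_criterion[of "{\<one>, x, y}"] bas that car one_in_carrier unfolding lc xy(1) by auto
  \<comment> \<open>Uniqueness of coefficients is known for functions on the basis; \<open>g\<close> turns a triple into one.\<close>
  define g where "g a b c = (\<lambda>z\<in>{\<one>, x, y}. if z = \<one> then a else if z = x then b else c)" for a b c :: complex
  have g: "g a b c \<in> {\<one>, x, y} \<rightarrow>\<^sub>E UNIV" "g a b c \<one> = a" "g a b c x = b" "g a b c y = c" for a b c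
    using ne xy by (auto simp: g_def)
  have "frame x y" unfolding frame_def bij_betw_def
  proof (intro conjI car inj_onI)
    fix u v :: "complex \<times> complex \<times> complex"
    assume e: "(case u of (a, b, c) \<Rightarrow> comb x y a b c) = (case v of (a, b, c) \<Rightarrow> comb x y a b c)"
    obtain a b c a' b' c' where uv: "u = (a, b, c)" "v = (a', b', c')" by (metis prod_cases3)
    have "g a b c = g a' b' c'"
      using uniq[of "comb x y a b c"] g e car uv by (metis comb_closed old.prod.case)
    then show "u = v" using g uv by metis
  next
    show "(\<lambda>(a, b, c). comb x y a b c) ` UNIV = carrier A"
    proof (intro equalityI subsetI)
      fix v assume "v \<in> carrier A"
      then obtain f where "comb x y (f \<one>) (f x) (f y) = v" using uniq by blast
      then show "v \<in> (\<lambda>(a, b, c). comb x y a b c) ` UNIV"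
        by (intro image_eqI[of _ _ "(f \<one>, f x, f y)"]) auto
    qed (use car in auto)
  qed
  then show thesis by (rule that)
qed

end

section \<open>Isomorphisms and the algebras with basis \<open>U, X, Y\<close>\<close>

lemma alg_isomorphicI:
  assumes "h \<in> Ring.ring_hom A B" "bij_betw h (carrier A) (carrier B)"
    and "\<And>c x. x \<in> carrier A \<Longrightarrow> h (c \<odot>\<^bsub>A\<^esub> x) = c \<odot>\<^bsub>B\<^esub> h x"
  shows "A \<cong>\<^sub>J B"
  using assms unfolding alg_isomorphic_def ring_iso_def by (intro bexI[of _ h]) auto

text \<open>
  Closure of the source under the operations lets the inverse cancel the isomorphism on values such as
  \<open>x \<otimes> y\<close>, which is why the inverse is again a homomorphism.
\<close>

lemma alg_isomorphic_sym:
  assumes iso: "A \<cong>\<^sub>J B"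
    and one: "\<one>\<^bsub>A\<^esub> \<in> carrier A"
    and add: "\<And>x y. \<lbrakk>x \<in> carrier A; y \<in> carrier A\<rbrakk> \<Longrightarrow> x \<oplus>\<^bsub>A\<^esub> y \<in> carrier A"
    and mult: "\<And>x y. \<lbrakk>x \<in> carrier A; y \<in> carrier A\<rbrakk> \<Longrightarrow> x \<otimes>\<^bsub>A\<^esub> y \<in> carrier A"
    and smult: "\<And>c x. x \<in> carrier A \<Longrightarrow> c \<odot>\<^bsub>A\<^esub> x \<in> carrier A"
  shows "B \<cong>\<^sub>J A"
proof -
  obtain h where h: "h \<in> Ring.ring_hom A B" "bij_betw h (carrier A) (carrier B)"
    and hs: "\<And>c x. x \<in> carrier A \<Longrightarrow> h (c \<odot>\<^bsub>A\<^esub> x) = c \<odot>\<^bsub>B\<^esub> h x"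
    using iso by (auto simp: alg_isomorphic_def ring_iso_def)
  let ?g = "inv_into (carrier A) h"
  have bij: "bij_betw ?g (carrier B) (carrier A)" using h(2) by (rule bij_betw_inv_into)
  have gin: "?g u \<in> carrier A" and hg: "h (?g u) = u" if "u \<in> carrier B" for u
    using that bij h(2) by (auto simp: bij_betw_apply bij_betw_inv_into_right)
  have gh: "?g (h x) = x" if "x \<in> carrier A" for x
    using that h(2) by (simp add: bij_betw_inv_into_left)
  have "?g \<in> Ring.ring_hom B A"
  proof (rule ring_hom_memI)
    fix u v assume uv: "u \<in> carrier B" "v \<in> carrier B"
    show "?g (u \<otimes>\<^bsub>B\<^esub> v) = ?g u \<otimes>\<^bsub>A\<^esub> ?g v"
      using ring_hom_mult[OF h(1) gin[OF uv(1)] gin[OF uv(2)]] gh[OF mult[OF gin[OF uv(1)] gin[OF uv(2)]]]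
      by (simp add: hg uv)
    show "?g (u \<oplus>\<^bsub>B\<^esub> v) = ?g u \<oplus>\<^bsub>A\<^esub> ?g v"
      using ring_hom_add[OF h(1) gin[OF uv(1)] gin[OF uv(2)]] gh[OF add[OF gin[OF uv(1)] gin[OF uv(2)]]]
      by (simp add: hg uv)
  qed (use gin ring_hom_one[OF h(1)] gh[OF one] in auto)
  moreover have "?g (c \<odot>\<^bsub>B\<^esub> u) = c \<odot>\<^bsub>A\<^esub> ?g u" if "u \<in> carrier B" for c u
    using hs[OF gin[OF that]] gh[OF smult[OF gin[OF that]]] by (simp add: hg that)
  ultimately show ?thesis using bij unfolding alg_isomorphic_def ring_iso_def by blast
qed

lemma alg_isomorphic_trans: "\<lbrakk>A \<cong>\<^sub>J B; B \<cong>\<^sub>J C\<rbrakk> \<Longrightarrow> A \<cong>\<^sub>J C"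
  unfolding alg_isomorphic_def
proof (elim bexE)
  fix f g assume f: "f \<in> ring_iso A B" "\<forall>c. \<forall>x\<in>carrier A. f (c \<odot>\<^bsub>A\<^esub> x) = c \<odot>\<^bsub>B\<^esub> f x"
    and g: "g \<in> ring_iso B C" "\<forall>c. \<forall>x\<in>carrier B. g (c \<odot>\<^bsub>B\<^esub> x) = c \<odot>\<^bsub>C\<^esub> g x"
  have "g \<circ> f \<in> ring_iso A C" using f g by (intro ring_iso_set_trans)
  moreover have "f x \<in> carrier B" if "x \<in> carrier A" for x
    using f(1) that by (auto simp: ring_iso_def intro: ring_hom_closed)
  ultimately show "\<exists>h\<in>ring_iso A C. \<forall>c. \<forall>x\<in>carrier A. h (c \<odot>\<^bsub>A\<^esub> x) = c \<odot>\<^bsub>C\<^esub> h x"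
    using f g by (intro bexI[of _ "g \<circ> f"]) auto
qed

lemma UXY_sel [simp]:
  "carrier (UXY_algebra p q r) = carrier_vec 3" "\<one>\<^bsub>UXY_algebra p q r\<^esub> = U_vec"
  "\<zero>\<^bsub>UXY_algebra p q r\<^esub> = 0\<^sub>v 3" "v \<oplus>\<^bsub>UXY_algebra p q r\<^esub> w = v + w"
  "c \<odot>\<^bsub>UXY_algebra p q r\<^esub> v = c \<cdot>\<^sub>v v"
  by (simp_all add: UXY_algebra_def module_vec_def)

lemma UXY_mult_closed [simp]:
  assumes "p \<in> carrier_vec 3" "q \<in> carrier_vec 3" "r \<in> carrier_vec 3"
  shows "v \<otimes>\<^bsub>UXY_algebra p q r\<^esub> w \<in> carrier_vec 3"
  using assms by (simp add: UXY_algebra_def)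

lemma UXY_mult_index:
  assumes "p \<in> carrier_vec 3" "q \<in> carrier_vec 3" "r \<in> carrier_vec 3"
  shows "(v \<otimes>\<^bsub>UXY_algebra p q r\<^esub> w) $ 0 =
      v $ 0 * w $ 0 + v $ 1 * w $ 1 * p $ 0 + v $ 2 * w $ 2 * q $ 0 + (v $ 1 * w $ 2 + v $ 2 * w $ 1) * r $ 0"
    "(v \<otimes>\<^bsub>UXY_algebra p q r\<^esub> w) $ 1 =
      v $ 0 * w $ 1 + v $ 1 * w $ 0 + v $ 1 * w $ 1 * p $ 1 + v $ 2 * w $ 2 * q $ 1 + (v $ 1 * w $ 2 + v $ 2 * w $ 1) * r $ 1"
    "(v \<otimes>\<^bsub>UXY_algebra p q r\<^esub> w) $ 2 =
      v $ 0 * w $ 2 + v $ 2 * w $ 0 + v $ 1 * w $ 1 * p $ 2 + v $ 2 * w $ 2 * q $ 2 + (v $ 1 * w $ 2 + v $ 2 * w $ 1) * r $ 2"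
  using assms by (simp_all add: UXY_algebra_def unit_vec_def)

lemma UXY_isomorphic_sym:
  assumes "UXY_algebra p q r \<cong>\<^sub>J B" "p \<in> carrier_vec 3" "q \<in> carrier_vec 3" "r \<in> carrier_vec 3"
  shows "B \<cong>\<^sub>J UXY_algebra p q r"
  using assms by (intro alg_isomorphic_sym[OF assms(1)]) auto

lemma vec3_eqI:
  assumes "v \<in> carrier_vec 3" "w \<in> carrier_vec 3" "v $ 0 = w $ 0" "v $ 1 = w $ 1" "v $ 2 = w $ 2"
  shows "v = w"
  using assms by (intro eq_vecI) (auto simp: less_Suc_eq numeral_3_eq_3 numeral_2_eq_2)

context jordan_algebra
begin

text \<open>
  Reading coordinates off a basis is an isomorphism onto the algebra with the same structure constants.
\<close>

lemma frame_isomorphic_UXY: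
  assumes fr: "frame x y"
    and pqr: "p \<in> carrier_vec 3" "q \<in> carrier_vec 3" "r \<in> carrier_vec 3"
    and xx: "x \<otimes> x = comb x y (p $ 0) (p $ 1) (p $ 2)"
    and yy: "y \<otimes> y = comb x y (q $ 0) (q $ 1) (q $ 2)"
    and xy: "x \<otimes> y = comb x y (r $ 0) (r $ 1) (r $ 2)"
  shows "A \<cong>\<^sub>J UXY_algebra p q r"
proof -
  note car = frame_carrier[OF fr]
  let ?B = "UXY_algebra p q r"
  let ?h = "\<lambda>v. comb x y (v $ 0) (v $ 1) (v $ 2)"
  have bij: "bij_betw ?h (carrier ?B) (carrier A)"
    unfolding bij_betw_def
  proof (intro conjI inj_onI equalityI subsetI)
    fix v w assume "v \<in> carrier ?B" "w \<in> carrier ?B" "?h v = ?h w"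
    then show "v = w" by (intro vec3_eqI) (simp_all add: frame_eq_iff[OF fr])
  next
    fix z assume "z \<in> carrier A"
    then obtain a b c where z: "z = comb x y a b c" using frame_coords[OF fr] by blast
    show "z \<in> ?h ` carrier ?B"
      by (rule image_eqI[of _ _ "vec_of_list [a, b, c]"])
        (simp_all add: z numeral_2_eq_2 carrier_vecI)
  qed (use car in auto)
  \<comment> \<open>The index 1 is kept as a numeral so that the component formulas of the product apply.\<close>
  have hom: "?h \<in> Ring.ring_hom ?B A"
    using car pqr
    by (intro ring_hom_memI)
      (simp_all add: comb_add UXY_mult_index[OF pqr] comb_mult[OF car xx yy xy] comb_units
        del: One_nat_def)
  have "?h (c \<odot>\<^bsub>?B\<^esub> v) = c \<odot>\<^bsub>A\<^esub> ?h v" if "v \<in> carrier ?B" for c v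
    using car that by (simp add: comb_smult)
  then have "?B \<cong>\<^sub>J A" by (rule alg_isomorphicI[OF hom bij])
  then show ?thesis using pqr by (rule UXY_isomorphic_sym)
qed

lemma frame_isomorphic:
  assumes fr: "frame x y"
  shows
    "\<lbrakk>x \<otimes> x = x; y \<otimes> y = y; x \<otimes> y = \<zero>\<rbrakk> \<Longrightarrow> A \<cong>\<^sub>J algebra_1a"
    "\<lbrakk>x \<otimes> x = \<one>; y \<otimes> y = \<one>; x \<otimes> y = \<zero>\<rbrakk> \<Longrightarrow> A \<cong>\<^sub>J algebra_1b"
    "\<lbrakk>x \<otimes> x = x; y \<otimes> y = \<zero>; x \<otimes> y = \<zero>\<rbrakk> \<Longrightarrow> A \<cong>\<^sub>J algebra_2a"
    "\<lbrakk>x \<otimes> x = x; y \<otimes> y = \<zero>; x \<otimes> y = (1 / 2) \<odot>\<^bsub>A\<^esub> y\<rbrakk> \<Longrightarrow> A \<cong>\<^sub>J algebra_2b"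
    "\<lbrakk>x \<otimes> x = y; y \<otimes> y = \<zero>; x \<otimes> y = \<zero>\<rbrakk> \<Longrightarrow> A \<cong>\<^sub>J algebra_3a"
    "\<lbrakk>x \<otimes> x = \<zero>; y \<otimes> y = \<zero>; x \<otimes> y = \<zero>\<rbrakk> \<Longrightarrow> A \<cong>\<^sub>J algebra_3b"
proof -
  note car = frame_carrier[OF fr]
  have half: "comb x y 0 0 (1 / 2) = (1 / 2) \<odot>\<^bsub>A\<^esub> y"
    using comb_smult[OF car, of "1 / 2" 0 0 1] comb_units[OF car] by simp
  note defs = algebra_1a_def algebra_1b_def algebra_2a_def algebra_2b_def algebra_3a_def algebra_3b_def
  show "\<lbrakk>x \<otimes> x = x; y \<otimes> y = y; x \<otimes> y = \<zero>\<rbrakk> \<Longrightarrow> A \<cong>\<^sub>J algebra_1a"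
    "\<lbrakk>x \<otimes> x = \<one>; y \<otimes> y = \<one>; x \<otimes> y = \<zero>\<rbrakk> \<Longrightarrow> A \<cong>\<^sub>J algebra_1b"
    "\<lbrakk>x \<otimes> x = x; y \<otimes> y = \<zero>; x \<otimes> y = \<zero>\<rbrakk> \<Longrightarrow> A \<cong>\<^sub>J algebra_2a"
    "\<lbrakk>x \<otimes> x = x; y \<otimes> y = \<zero>; x \<otimes> y = (1 / 2) \<odot>\<^bsub>A\<^esub> y\<rbrakk> \<Longrightarrow> A \<cong>\<^sub>J algebra_2b"
    "\<lbrakk>x \<otimes> x = y; y \<otimes> y = \<zero>; x \<otimes> y = \<zero>\<rbrakk> \<Longrightarrow> A \<cong>\<^sub>J algebra_3a"
    "\<lbrakk>x \<otimes> x = \<zero>; y \<otimes> y = \<zero>; x \<otimes> y = \<zero>\<rbrakk> \<Longrightarrow> A \<cong>\<^sub>J algebra_3b"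
    unfolding defs by (rule frame_isomorphic_UXY[OF fr]; simp add: comb_units car half)+
qed

lemma frame_scale:
  assumes fr: "frame x y" and "k \<noteq> 0" "l \<noteq> 0"
  shows "frame (k \<odot>\<^bsub>A\<^esub> x) (l \<odot>\<^bsub>A\<^esub> y)"
proof -
  note car = frame_carrier[OF fr]
  have "frame (comb x y 0 k 0) (comb x y 0 0 l)" using frame_change[OF fr] assms by simp
  moreover have "comb x y 0 k 0 = k \<odot>\<^bsub>A\<^esub> x" "comb x y 0 0 l = l \<odot>\<^bsub>A\<^esub> y"
    using comb_smult[OF car, of k 0 1 0] comb_smult[OF car, of l 0 0 1] comb_units[OF car] by simp_all
  ultimately show ?thesis by simp
qed

lemma mult_smult_smult:
  "\<lbrakk>x \<in> carrier A; y \<in> carrier A\<rbrakk> \<Longrightarrow> (k \<odot>\<^bsub>A\<^esub> x) \<otimes> (l \<odot>\<^bsub>A\<^esub> y) = (k * l) \<odot>\<^bsub>A\<^esub> (x \<otimes> y)"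
  by (simp add: mult_smult_left mult_smult_right mult_closed mult.commute
      flip: smult_mult_scalars)

lemma smult_zero_vector: "k \<odot>\<^bsub>A\<^esub> \<zero> = \<zero>"
  using rmult_0[of k] by simp

text \<open>
  Idempotents are found below as multiples of elements with \<open>x\<^sup>2 = m x\<close>, which keeps the coordinate
  identities polynomial.
\<close>

lemma idempotent_scale:
  assumes "x \<in> carrier A" "x \<otimes> x = m \<odot>\<^bsub>A\<^esub> x" "m \<noteq> 0"
  shows "((1 / m) \<odot>\<^bsub>A\<^esub> x) \<otimes> ((1 / m) \<odot>\<^bsub>A\<^esub> x) = (1 / m) \<odot>\<^bsub>A\<^esub> x"
  using assms by (simp add: mult_smult_smult flip: smult_mult_scalars)

end

section \<open>Algebras generated by one element\<close>

lemma cubic_roots: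
  fixes c0 c1 c2 :: complex
  obtains \<alpha> \<beta> \<gamma> where "c0 = \<alpha> * \<beta> * \<gamma>" "c1 = - (\<alpha> * \<beta> + \<beta> * \<gamma> + \<gamma> * \<alpha>)" "c2 = \<alpha> + \<beta> + \<gamma>"
proof -
  have "\<not> constant (poly [:- c0, - c1, - c2, 1:])"
    by (simp add: constant_degree)
  then obtain \<alpha> where \<alpha>: "poly [:- c0, - c1, - c2, 1:] \<alpha> = 0"
    using fundamental_theorem_of_algebra by blast
  define p where "p = c2 - \<alpha>"
  define q where "q = \<alpha> * \<alpha> - c2 * \<alpha> - c1"
  define s where "s = csqrt (p\<^sup>2 - 4 * q)"
  have s: "s * s = p * p - 4 * q" unfolding s_def by (metis power2_csqrt power2_eq_square)
  let ?\<beta> = "(p + s) / 2" and ?\<gamma> = "(p - s) / 2"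
  have sum: "?\<beta> + ?\<gamma> = p" by (simp add: field_simps)
  have prod: "?\<beta> * ?\<gamma> = q" using s by (simp add: field_simps)
  show thesis
  proof (rule that[of \<alpha> ?\<beta> ?\<gamma>])
    show "c2 = \<alpha> + ?\<beta> + ?\<gamma>" using sum by (simp add: p_def add.assoc)
    have "\<alpha> * ?\<beta> + ?\<beta> * ?\<gamma> + ?\<gamma> * \<alpha> = \<alpha> * (?\<beta> + ?\<gamma>) + ?\<beta> * ?\<gamma>" by (simp only: distrib_left ac_simps)
    also have "\<dots> = \<alpha> * p + q" by (simp only: sum prod)
    finally show "c1 = - (\<alpha> * ?\<beta> + ?\<beta> * ?\<gamma> + ?\<gamma> * \<alpha>)"
      by (simp only:) (simp add: p_def q_def algebra_simps)
    have "\<alpha> * ?\<beta> * ?\<gamma> = \<alpha> * q" using prod by (simp only: mult.assoc)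
    then show "c0 = \<alpha> * ?\<beta> * ?\<gamma>" using \<alpha> by (simp add: q_def algebra_simps)
  qed
qed

context jordan_algebra
begin

text \<open>
  The equation \<open>x\<^sup>3 = c0 + c1 x + c2 x\<^sup>2\<close> determines the whole product on the span of \<open>\<one>, x, x\<^sup>2\<close>. The
  only product that it does not give directly is \<open>x\<^sup>2 \<otimes> x\<^sup>2\<close>, which the Jordan identity reduces to
  \<open>x \<otimes> x\<^sup>3\<close>. The result is multiplication modulo a cubic polynomial.
\<close>

lemma generator_mult:
  assumes x: "x \<in> carrier A" and xz: "x \<otimes> (x \<otimes> x) = comb x (x \<otimes> x) c0 c1 c2"
  shows "comb x (x \<otimes> x) a b c \<otimes> comb x (x \<otimes> x) a' b' c' = comb x (x \<otimes> x)
     (a * a' + c * c' * (c2 * c0) + (b * c' + c * b') * c0)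
     (a * b' + b * a' + c * c' * (c0 + c2 * c1) + (b * c' + c * b') * c1)
     (a * c' + c * a' + b * b' + c * c' * (c1 + c2 * c2) + (b * c' + c * b') * c2)"
proof -
  let ?z = "x \<otimes> x"
  have z: "?z \<in> carrier A" using x by (simp add: mult_closed)
  have "?z \<otimes> ?z = x \<otimes> comb x ?z c0 c1 c2"
    using jordan_identity[OF x x] mult_commute[OF x z] xz by simp
  also have "\<dots> = c0 \<odot>\<^bsub>A\<^esub> x \<oplus> c1 \<odot>\<^bsub>A\<^esub> ?z \<oplus> c2 \<odot>\<^bsub>A\<^esub> comb x ?z c0 c1 c2"
    using x z mult_commute[OF x one_in_carrier] xz
    by (simp add: comb_def mult_add_right mult_smult_right one_in_carrier one_mult mult_closed)
  also have "\<dots> = c0 \<odot>\<^bsub>A\<^esub> comb x ?z 0 1 0 \<oplus> c1 \<odot>\<^bsub>A\<^esub> comb x ?z 0 0 1 \<oplus> c2 \<odot>\<^bsub>A\<^esub> comb x ?z c0 c1 c2"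
    using comb_units[OF x z] by simp
  also have "\<dots> = comb x ?z (c2 * c0) (c0 + c2 * c1) (c1 + c2 * c2)"
    by (simp add: comb_smult comb_add x z)
  finally have zz: "?z \<otimes> ?z = comb x ?z (c2 * c0) (c0 + c2 * c1) (c1 + c2 * c2)" .
  have xx: "x \<otimes> x = comb x ?z 0 0 1" using comb_units[OF x z] by simp
  show ?thesis using comb_mult[OF x z xx zz xz, of a b c a' b' c'] by (simp add: add.assoc)
qed

text \<open>
  Translating the generator by a root of its cubic moves that root to \<open>0\<close>, so that the cubic becomes
  \<open>z (z - s) (z - t)\<close> with the differences \<open>s\<close> and \<open>t\<close> of the roots.
\<close>

lemma generator_shift:
  assumes fr: "frame x (x \<otimes> x)"
    and xz: "x \<otimes> (x \<otimes> x) = comb x (x \<otimes> x) (\<alpha> * \<beta> * \<gamma>) (- (\<alpha> * \<beta> + \<beta> * \<gamma> + \<gamma> * \<alpha>)) (\<alpha> + \<beta> + \<gamma>)"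
  defines "s \<equiv> \<beta> - \<alpha>" and "t \<equiv> \<gamma> - \<alpha>"
  obtains w where "frame w (w \<otimes> w)" "w \<otimes> (w \<otimes> w) = comb w (w \<otimes> w) 0 (- (s * t)) (s + t)"
proof -
  let ?z = "x \<otimes> x"
  note car = frame_carrier[OF fr]
  let ?w = "comb x ?z (- \<alpha>) 1 0"
  have ww: "?w \<otimes> ?w = comb x ?z (\<alpha> * \<alpha>) (- 2 * \<alpha>) 1"
    by (simp add: generator_mult[OF car(1) xz])
  have "frame ?w (?w \<otimes> ?w)" unfolding ww by (rule frame_change[OF fr]) simp
  moreover have "?w \<otimes> (?w \<otimes> ?w) = comb ?w (?w \<otimes> ?w) 0 (- (s * t)) (s + t)"
    unfolding ww comb_comb[OF car] generator_mult[OF car(1) xz] frame_eq_iff[OF fr] s_def t_def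
    by (simp add: algebra_simps)
  ultimately show thesis by (rule that)
qed

lemma generator_triple_root:
  assumes "frame x (x \<otimes> x)" "x \<otimes> (x \<otimes> x) = comb x (x \<otimes> x) 0 0 0"
  shows "A \<cong>\<^sub>J algebra_3a"
proof -
  note car = frame_carrier[OF assms(1)]
  have "(x \<otimes> x) \<otimes> (x \<otimes> x) = \<zero>"
    using generator_mult[OF car(1) assms(2), of 0 0 1 0 0 1] comb_units[OF car] by simp
  then show ?thesis
    using frame_isomorphic(5)[OF assms(1)] assms(2) comb_units[OF car] by simp
qed

text \<open>
  For the cubic \<open>z\<^sup>2 (z - t)\<close>, the element \<open>x\<^sup>2/t\<^sup>2\<close> is the idempotent that belongs to the simple root
  \<open>t\<close>, and \<open>x (x - t)\<close> is annihilated by \<open>x\<^sup>2\<close> and squares to zero.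
\<close>

lemma generator_double_root:
  assumes fr: "frame x (x \<otimes> x)" and xz: "x \<otimes> (x \<otimes> x) = comb x (x \<otimes> x) 0 0 t" and t: "t \<noteq> 0"
  shows "A \<cong>\<^sub>J algebra_2a"
proof -
  let ?z = "x \<otimes> x" and ?m = "t * t"
  note car = frame_carrier[OF fr]
  note units = comb_units[OF car]
  let ?y = "comb x ?z 0 (- t) 1"
  have "?z \<otimes> ?z = ?m \<odot>\<^bsub>A\<^esub> ?z"
    using generator_mult[OF car(1) xz, of 0 0 1 0 0 1] comb_smult[OF car, of ?m 0 0 1] units by simp
  note idem = idempotent_scale[OF car(2) this]
  have yy: "?y \<otimes> ?y = \<zero>" and zy: "?z \<otimes> ?y = \<zero>"
    using generator_mult[OF car(1) xz, of 0 "- t" 1 0 "- t" 1]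
      generator_mult[OF car(1) xz, of 0 0 1 0 "- t" 1] units by simp_all
  have "frame ?z ?y"
    using frame_change[OF fr, of 0 1 1 "- t" 0 0] t units by simp
  then have "frame ((1 / ?m) \<odot>\<^bsub>A\<^esub> ?z) (1 \<odot>\<^bsub>A\<^esub> ?y)"
    using t by (intro frame_scale) auto
  then have "frame ((1 / ?m) \<odot>\<^bsub>A\<^esub> ?z) ?y"
    using car by (simp add: one_smult)
  then show ?thesis
    by (rule frame_isomorphic(3)[OF _ idem yy]) (simp_all add: t car zy mult_smult_left smult_zero_vector)
qed

text \<open>
  For the cubic \<open>z (z - s) (z - t)\<close>, Lagrange interpolation at the roots \<open>s\<close> and \<open>t\<close> gives two orthogonal
  idempotents, the normalised \<open>x (x - t)\<close> and \<open>x (x - s)\<close>.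
\<close>

lemma generator_distinct_roots:
  assumes fr: "frame x (x \<otimes> x)" and xz: "x \<otimes> (x \<otimes> x) = comb x (x \<otimes> x) 0 (- (s * t)) (s + t)"
    and st: "s \<noteq> 0" "t \<noteq> 0" "s \<noteq> t"
  shows "A \<cong>\<^sub>J algebra_1a"
proof -
  let ?z = "x \<otimes> x" and ?m = "s * (s - t)" and ?n = "t * (t - s)"
  note car = frame_carrier[OF fr]
  let ?x = "comb x ?z 0 (- t) 1" and ?y = "comb x ?z 0 (- s) 1"
  have xx: "?x \<otimes> ?x = ?m \<odot>\<^bsub>A\<^esub> ?x" and yy: "?y \<otimes> ?y = ?n \<odot>\<^bsub>A\<^esub> ?y" and xy: "?x \<otimes> ?y = comb x ?z 0 0 0"
    unfolding generator_mult[OF car(1) xz] comb_smult[OF car] frame_eq_iff[OF fr]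
    by (simp_all add: algebra_simps)
  have xy': "?x \<in> carrier A" "?y \<in> carrier A" using car by simp_all
  have mn: "?m \<noteq> 0" "?n \<noteq> 0" using st by auto
  have "frame ?x ?y"
    using frame_change[OF fr, of "- t" 1 1 "- s" 0 0] st by simp
  then have fr': "frame ((1 / ?m) \<odot>\<^bsub>A\<^esub> ?x) ((1 / ?n) \<odot>\<^bsub>A\<^esub> ?y)"
    using mn by (intro frame_scale) auto
  show ?thesis
    using frame_isomorphic(1)[OF fr' idempotent_scale[OF xy'(1) xx mn(1)]
        idempotent_scale[OF xy'(2) yy mn(2)]] mult_smult_smult[OF xy', of "1 / ?m" "1 / ?n"] xy
    by (simp add: comb_units car smult_zero_vector)
qed

text \<open>
  The relation between \<open>x\<^sup>3\<close> and the roots is symmetric in them. So if any two coincide, they may be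
  taken to be the first two, and the shift moves the double root to \<open>0\<close>.
\<close>

lemma generator_classification:
  assumes fr: "frame x (x \<otimes> x)"
  shows "A \<cong>\<^sub>J algebra_1a \<or> A \<cong>\<^sub>J algebra_2a \<or> A \<cong>\<^sub>J algebra_3a"
proof -
  note car = frame_carrier[OF fr]
  let ?f = "\<lambda>\<alpha> \<beta> \<gamma>. comb x (x \<otimes> x) (\<alpha> * \<beta> * \<gamma>) (- (\<alpha> * \<beta> + \<beta> * \<gamma> + \<gamma> * \<alpha>)) (\<alpha> + \<beta> + \<gamma>)"
  obtain c0 c1 c2 where c: "x \<otimes> (x \<otimes> x) = comb x (x \<otimes> x) c0 c1 c2"
    using frame_coords[OF fr] mult_closed[OF car] by metis
  obtain \<alpha> \<beta> \<gamma> where abc: "x \<otimes> (x \<otimes> x) = ?f \<alpha> \<beta> \<gamma>"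
    using cubic_roots[of c0 c1 c2] c by metis
  have rot: "?f \<alpha> \<beta> \<gamma> = ?f \<beta> \<gamma> \<alpha>" for \<alpha> \<beta> \<gamma>
    by (simp add: ac_simps)
  have double: ?thesis if root: "x \<otimes> (x \<otimes> x) = ?f \<alpha> \<alpha> \<gamma>" for \<alpha> \<gamma>
  proof -
    obtain w where w: "frame w (w \<otimes> w)" "w \<otimes> (w \<otimes> w) = comb w (w \<otimes> w) 0 0 (\<gamma> - \<alpha>)"
      using generator_shift[OF fr root] by auto
    show ?thesis
      using generator_triple_root[OF w(1)] generator_double_root[OF w] w(2) by (cases "\<gamma> = \<alpha>") auto
  qed
  have distinct: ?thesis if "\<alpha> \<noteq> \<beta>" "\<alpha> \<noteq> \<gamma>" "\<beta> \<noteq> \<gamma>"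
  proof -
    obtain w where w: "frame w (w \<otimes> w)"
      "w \<otimes> (w \<otimes> w) = comb w (w \<otimes> w) 0 (- ((\<beta> - \<alpha>) * (\<gamma> - \<alpha>))) ((\<beta> - \<alpha>) + (\<gamma> - \<alpha>))"
      using generator_shift[OF fr abc] .
    show ?thesis
      using generator_distinct_roots[OF w] that by auto
  qed
  consider "\<alpha> = \<beta>" | "\<beta> = \<gamma>" | "\<alpha> = \<gamma>" | "\<alpha> \<noteq> \<beta>" "\<alpha> \<noteq> \<gamma>" "\<beta> \<noteq> \<gamma>" by blast
  then show ?thesis
    by cases (use abc double rot distinct in metis)+
qed

end

section \<open>Algebras in which every element is quadratic\<close>

context jordan_algebra
begin

text \<open>
  If no \<open>w\<close> generates the algebra, then \<open>w\<^sup>2\<close> lies in the span of \<open>\<one>\<close> and \<open>w\<close> for all nonscalar \<open>w\<close>. For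
  \<open>w = b x + c y\<close> this is the vanishing of a determinant that is a cubic form in \<open>b\<close> and \<open>c\<close>. Its values
  at \<open>(1, 0)\<close>, \<open>(0, 1)\<close>, \<open>(1, 1)\<close> and \<open>(1, -1)\<close> give \<open>x\<^sup>2 = 2 r2 x\<close>, \<open>y\<^sup>2 = 2 r1 y\<close> and
  \<open>x \<otimes> y = r1 x + r2 y\<close> modulo \<open>\<one>\<close>. Completing the square with \<open>x - r2\<close> and \<open>y - r1\<close> removes these
  linear terms from all three products at once.
\<close>

lemma quadratic_form_shape:
  assumes fr: "frame x y" and quad: "\<And>w. \<not> frame w (w \<otimes> w)"
  obtains u v a b c where "frame u v"
    "u \<otimes> u = a \<odot>\<^bsub>A\<^esub> \<one>" "v \<otimes> v = b \<odot>\<^bsub>A\<^esub> \<one>" "u \<otimes> v = c \<odot>\<^bsub>A\<^esub> \<one>"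
proof -
  note car = frame_carrier[OF fr]
  obtain p0 p1 p2 where xx: "x \<otimes> x = comb x y p0 p1 p2"
    using frame_coords[OF fr] mult_closed[OF car(1,1)] by metis
  obtain q0 q1 q2 where yy: "y \<otimes> y = comb x y q0 q1 q2"
    using frame_coords[OF fr] mult_closed[OF car(2,2)] by metis
  obtain r0 r1 r2 where xy: "x \<otimes> y = comb x y r0 r1 r2"
    using frame_coords[OF fr] mult_closed[OF car] by metis
  note mult = comb_mult[OF car xx yy xy]
  have sq: "b * (b * b * p2 + c * c * q2 + (b * c + c * b) * r2)
      = c * (b * b * p1 + c * c * q1 + (b * c + c * b) * r1)" for b c
    using frame_change[OF fr, of b _ c _ 0 _] quad[of "comb x y 0 b c"] unfolding mult by fastforce
  have p2: "p2 = 0" and q1: "q1 = 0" and e: "q2 + 2 * r2 = p1 + 2 * r1" "q2 - 2 * r2 = - p1 + 2 * r1"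
    using sq[of 1 0] sq[of 0 1] sq[of 1 1] sq[of 1 "- 1"] by (auto simp: algebra_simps)
  have "(q2 + 2 * r2) + (q2 - 2 * r2) = (p1 + 2 * r1) + (- p1 + 2 * r1)"
    by (simp only: e)
  then have q2: "q2 = 2 * r1" by simp
  with e(1) have p1: "p1 = 2 * r2" by simp
  let ?u = "comb x y (- r2) 1 0" and ?v = "comb x y (- r1) 0 1"
  have sc: "k \<odot>\<^bsub>A\<^esub> \<one> = comb x y k 0 0" for k
    using comb_smult[OF car, of k 1 0 0] comb_units[OF car] by simp
  have "frame ?u ?v" by (rule frame_change[OF fr]) simp
  moreover have "?u \<otimes> ?u = (p0 + r2 * r2) \<odot>\<^bsub>A\<^esub> \<one>" "?v \<otimes> ?v = (q0 + r1 * r1) \<odot>\<^bsub>A\<^esub> \<one>"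
    "?u \<otimes> ?v = (r0 + r1 * r2) \<odot>\<^bsub>A\<^esub> \<one>"
    unfolding mult sc frame_eq_iff[OF fr] by (simp_all add: p1 p2 q1 q2)
  ultimately show thesis by (rule that)
qed

text \<open>
  A nonzero symmetric bilinear form has a vector of nonzero norm: if both basis vectors are isotropic,
  then their sum has norm \<open>2 c\<close>, twice the mixed coefficient.
\<close>

lemma form_nonisotropic_vector:
  assumes fr: "frame u v" and uu: "u \<otimes> u = a \<odot>\<^bsub>A\<^esub> \<one>" and vv: "v \<otimes> v = b \<odot>\<^bsub>A\<^esub> \<one>"
    and uv: "u \<otimes> v = c \<odot>\<^bsub>A\<^esub> \<one>" and nz: "a \<noteq> 0 \<or> b \<noteq> 0 \<or> c \<noteq> 0"
  obtains u' v' a' b' c' where "frame u' v'" "a' \<noteq> 0"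
    "u' \<otimes> u' = a' \<odot>\<^bsub>A\<^esub> \<one>" "v' \<otimes> v' = b' \<odot>\<^bsub>A\<^esub> \<one>" "u' \<otimes> v' = c' \<odot>\<^bsub>A\<^esub> \<one>"
proof -
  note car = frame_carrier[OF fr]
  note units = comb_units[OF car]
  have sc: "k \<odot>\<^bsub>A\<^esub> \<one> = comb u v k 0 0" for k
    using comb_smult[OF car, of k 1 0 0] units by simp
  consider "a \<noteq> 0" | "b \<noteq> 0" | "a = 0" "b = 0" "c \<noteq> 0" using nz by blast
  then show thesis
  proof cases
    case 1 then show thesis using that fr uu vv uv by blast
  next
    case 2
    have "frame v u" using frame_change[OF fr, of 0 0 1 1 0 0] units by simp
    then show thesis using that 2 uu vv uv mult_commute car by metis
  next
    case 3
    note mult = comb_mult[OF car uu[unfolded sc] vv[unfolded sc] uv[unfolded sc]]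
    let ?w = "comb u v 0 1 1"
    have "frame ?w v" using frame_change[OF fr, of 1 1 1 0 0 0] units by simp
    moreover have "?w \<otimes> ?w = (2 * c) \<odot>\<^bsub>A\<^esub> \<one>" "?w \<otimes> v = c \<odot>\<^bsub>A\<^esub> \<one>"
      using mult[of 0 1 1 0 1 1] mult[of 0 1 1 0 0 1] 3 by (simp_all add: sc units)
    ultimately show thesis using that[of ?w v "2 * c" b c] vv 3 by simp
  qed
qed

text \<open>
  The orthogonal complement of a nonisotropic \<open>u\<close> is spanned by \<open>v - (c/a) u\<close>, of norm \<open>d\<close>. Square roots
  of the norms normalise both vectors if \<open>d \<noteq> 0\<close>. If \<open>d = 0\<close>, the normalised \<open>x\<close> has \<open>x\<^sup>2 = \<one>\<close>, and the
  idempotent \<open>(\<one> + x)/2\<close> acts on the isotropic vector \<open>w\<close> as \<open>1/2\<close>, because \<open>x \<otimes> w = 0\<close>.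
\<close>

lemma form_classification:
  assumes fr: "frame u v" and uu: "u \<otimes> u = a \<odot>\<^bsub>A\<^esub> \<one>" and vv: "v \<otimes> v = b \<odot>\<^bsub>A\<^esub> \<one>"
    and uv: "u \<otimes> v = c \<odot>\<^bsub>A\<^esub> \<one>" and a: "a \<noteq> 0"
  shows "A \<cong>\<^sub>J algebra_1b \<or> A \<cong>\<^sub>J algebra_2b"
proof -
  note car = frame_carrier[OF fr]
  note units = comb_units[OF car]
  have sc: "k \<odot>\<^bsub>A\<^esub> \<one> = comb u v k 0 0" for k
    using comb_smult[OF car, of k 1 0 0] units by simp
  note mult = comb_mult[OF car uu[unfolded sc] vv[unfolded sc] uv[unfolded sc]]
  define k where "k = c / a"
  have c: "c = k * a" using a by (simp add: k_def)
  define d where "d = b - k * k * a"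
  let ?w = "comb u v 0 (- k) 1"
  have fr': "frame u ?w" using frame_change[OF fr, of 1 1 0 "- k" 0 0] units by simp
  have ww: "?w \<otimes> ?w = d \<odot>\<^bsub>A\<^esub> \<one>" and uw: "u \<otimes> ?w = \<zero>"
    using mult[of 0 "- k" 1 0 "- k" 1] mult[of 0 1 0 0 "- k" 1]
    by (simp_all add: sc units d_def c algebra_simps)
  have w: "?w \<in> carrier A" using car by simp
  define s where "s = csqrt a"
  have s: "s * s = a" "s \<noteq> 0" using a power2_csqrt[of a] by (auto simp: s_def power2_eq_square)
  let ?x = "(1 / s) \<odot>\<^bsub>A\<^esub> u"
  have "?x \<otimes> ?x = (1 / s * (1 / s) * a) \<odot>\<^bsub>A\<^esub> \<one>"
    by (simp only: mult_smult_smult[OF car(1,1)] uu smult_mult_scalars[OF one_in_carrier])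
  then have xx: "?x \<otimes> ?x = \<one>" using s by (auto simp: one_smult one_in_carrier)
  have x: "?x \<in> carrier A" and xw: "?x \<otimes> ?w = \<zero>"
    using car uw by (simp_all add: mult_smult_left smult_zero_vector)
  show ?thesis
  proof (cases "d = 0")
    case True
    have "frame ?x (1 \<odot>\<^bsub>A\<^esub> ?w)" using s by (intro frame_scale fr') auto
    then have fx: "frame ?x ?w" using w by (simp add: one_smult)
    note unitsx = comb_units[OF x w]
    have multx: "comb ?x ?w a b c \<otimes> comb ?x ?w a' b' c' =
        comb ?x ?w (a * a' + b * b') (a * b' + b * a') (a * c' + c * a')" for a b c a' b' c'
      using comb_mult[OF x w, of 1 0 0 0 0 0 0 0 0] xx ww xw True by (simp add: unitsx zero_smult one_in_carrier)
    let ?e = "comb ?x ?w (1 / 2) (1 / 2) 0"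
    have "frame ?e ?w" using frame_change[OF fx, of "1 / 2" 1 0 0 "1 / 2" 0] unitsx by simp
    moreover have "?e \<otimes> ?e = ?e" by (simp add: multx)
    moreover have "?e \<otimes> ?w = (1 / 2) \<odot>\<^bsub>A\<^esub> ?w"
      using multx[of "1 / 2" "1 / 2" 0 0 0 1] comb_smult[OF x w, of "1 / 2" 0 0 1] by (simp add: unitsx)
    moreover have "?w \<otimes> ?w = \<zero>" using ww True by (simp add: zero_smult one_in_carrier)
    ultimately show ?thesis using frame_isomorphic(4) by blast
  next
    case False
    define t where "t = csqrt d"
    have t: "t * t = d" "t \<noteq> 0" using False power2_csqrt[of d] by (auto simp: t_def power2_eq_square)
    let ?y = "(1 / t) \<odot>\<^bsub>A\<^esub> ?w"
    have "frame ?x ?y" using s t by (intro frame_scale fr') auto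
    moreover have "?y \<otimes> ?y = (1 / t * (1 / t) * d) \<odot>\<^bsub>A\<^esub> \<one>"
      by (simp only: mult_smult_smult[OF w w] ww smult_mult_scalars[OF one_in_carrier])
    then have "?y \<otimes> ?y = \<one>" using t by (auto simp: one_smult one_in_carrier)
    moreover have "?x \<otimes> ?y = \<zero>"
      using w x xw by (simp add: mult_smult_right smult_zero_vector)
    ultimately show ?thesis using frame_isomorphic(2) xx by blast
  qed
qed

lemma classification:
  assumes fin_dim "dim = 3"
  shows "A \<cong>\<^sub>J algebra_1a \<or> A \<cong>\<^sub>J algebra_1b \<or> A \<cong>\<^sub>J algebra_2a \<or> A \<cong>\<^sub>J algebra_2b \<or>
    A \<cong>\<^sub>J algebra_3a \<or> A \<cong>\<^sub>J algebra_3b"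
proof (cases "\<exists>x. frame x (x \<otimes> x)")
  case True
  then show ?thesis using generator_classification by blast
next
  case False
  obtain x y where "frame x y" using frame_exists assms by blast
  then obtain u v a b c where uv: "frame u v"
    "u \<otimes> u = a \<odot>\<^bsub>A\<^esub> \<one>" "v \<otimes> v = b \<odot>\<^bsub>A\<^esub> \<one>" "u \<otimes> v = c \<odot>\<^bsub>A\<^esub> \<one>"
    using quadratic_form_shape False by metis
  show ?thesis
  proof (cases "a = 0 \<and> b = 0 \<and> c = 0")
    case True
    then show ?thesis
      using frame_isomorphic(6)[OF uv(1)] uv one_in_carrier by (simp add: zero_smult)
  next
    case False
    then show ?thesis
      using form_nonisotropic_vector[OF uv] form_classification by metis
  qed
qed

end

section \<open>The quotient by the radical\<close>

context jordan_algebra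
begin

lemma mult_zero: "y \<in> carrier A \<Longrightarrow> \<zero> \<otimes> y = \<zero>"
  using mult_smult_left[of \<zero> y 0] by (simp add: zero_smult mult_closed)

lemma nat_pow_carrier: "x \<in> carrier A \<Longrightarrow> x [^] (n::nat) \<in> carrier A"
  by (induction n) (simp_all add: one_in_carrier mult_closed)

lemma ring_hom_nat_pow:
  assumes "h \<in> Ring.ring_hom A T" "x \<in> carrier A"
  shows "h (x [^] (n::nat)) = h x [^]\<^bsub>T\<^esub> n"
  using assms
  by (induction n) (simp_all add: ring_hom_one ring_hom_mult nat_pow_carrier)

end

text \<open>
  Surjections onto an algebra without radical whose kernel consists of nilpotent elements. The
  vector space laws of the target are inherited from \<open>A\<close> through surjectivity and \<open>h 0 = 0\<close>.
\<close>

locale radical_epimorphism = jordan_algebra A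
  for A :: "(complex, 'a) module" (structure) +
  fixes T :: "(complex, 'b) module" and h :: "'a \<Rightarrow> 'b"
  assumes hom: "h \<in> Ring.ring_hom A T"
    and surj: "h ` carrier A = carrier T"
    and hom_zero: "h \<zero> = \<zero>\<^bsub>T\<^esub>"
    and hom_smult: "x \<in> carrier A \<Longrightarrow> h (c \<odot>\<^bsub>A\<^esub> x) = c \<odot>\<^bsub>T\<^esub> h x"
    and kernel_nilpotent: "\<lbrakk>x \<in> carrier A; h x = \<zero>\<^bsub>T\<^esub>\<rbrakk> \<Longrightarrow> nilpotent A x"
    and rad_target: "rad T \<subseteq> {\<zero>\<^bsub>T\<^esub>}"
begin

lemma hom_simps:
  "\<lbrakk>x \<in> carrier A; y \<in> carrier A\<rbrakk> \<Longrightarrow> h (x \<otimes> y) = h x \<otimes>\<^bsub>T\<^esub> h y"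
  "\<lbrakk>x \<in> carrier A; y \<in> carrier A\<rbrakk> \<Longrightarrow> h (x \<oplus> y) = h x \<oplus>\<^bsub>T\<^esub> h y"
  "h \<one> = \<one>\<^bsub>T\<^esub>"
  using hom by (auto simp: ring_hom_mult ring_hom_add ring_hom_one)

lemma preimage:
  assumes "t \<in> carrier T"
  obtains x where "x \<in> carrier A" "t = h x"
  using assms unfolding surj[symmetric] by blast

lemma hom_add_kernel:
  assumes "x \<in> carrier A" "y \<in> carrier A" "h x = \<zero>\<^bsub>T\<^esub>"
  shows "h (x \<oplus> y) = h y"
  using hom_simps(2)[of \<zero> y] assms by (simp add: hom_simps(2) hom_zero)

text \<open>
  Nilpotency passes to images, so the image of a radical element lies in the radical of the target,
  which is zero. Conversely the kernel is an ideal, so a kernel element times anything is again a kernel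
  element and therefore nilpotent.
\<close>

lemma rad_eq_kernel: "rad A = {x \<in> carrier A. h x = \<zero>\<^bsub>T\<^esub>}"
proof (intro equalityI subsetI)
  fix x assume x: "x \<in> rad A"
  then have car: "x \<in> carrier A" by (simp add: rad_def)
  have "nilpotent T (h x \<otimes>\<^bsub>T\<^esub> t)" if t_in: "t \<in> carrier T" for t
  proof -
    obtain y where y: "y \<in> carrier A" "t = h y" using preimage[OF t_in] .
    obtain n :: nat where n: "n > 0" "(x \<otimes> y) [^] n = \<zero>"
      using x y by (auto simp: rad_def nilpotent_def)
    then have "(h x \<otimes>\<^bsub>T\<^esub> t) [^]\<^bsub>T\<^esub> n = \<zero>\<^bsub>T\<^esub>"
      using ring_hom_nat_pow[OF hom, of "x \<otimes> y" n] car y by (simp add: mult_closed hom_simps hom_zero)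
    then show ?thesis using n(1) by (auto simp: nilpotent_def)
  qed
  then have "h x \<in> rad T" using car surj by (auto simp: rad_def)
  then show "x \<in> {x \<in> carrier A. h x = \<zero>\<^bsub>T\<^esub>}" using rad_target car by auto
next
  fix x assume "x \<in> {x \<in> carrier A. h x = \<zero>\<^bsub>T\<^esub>}"
  then have x: "x \<in> carrier A" "h x = h \<zero>" by (simp_all add: hom_zero)
  have "nilpotent A (x \<otimes> y)" if y: "y \<in> carrier A" for y
  proof (rule kernel_nilpotent)
    have "h (x \<otimes> y) = h (\<zero> \<otimes> y)" using x y by (simp add: hom_simps(1))
    then show "h (x \<otimes> y) = \<zero>\<^bsub>T\<^esub>" using y by (simp add: mult_zero hom_zero)
  qed (simp add: x y mult_closed)
  then show "x \<in> rad A" using x by (simp add: rad_def)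
qed

text \<open>
  The cosets of the kernel, indexed by the elements of the target. This indexing is the inverse of the
  isomorphism from the quotient to the target.
\<close>

definition fibre :: "'b \<Rightarrow> 'a set" where
  "fibre t = {x \<in> carrier A. h x = t}"

lemma fibre_nonempty: "t \<in> carrier T \<Longrightarrow> fibre t \<noteq> {}"
  by (auto simp: fibre_def elim!: preimage)

lemma coset_eq_fibre:
  assumes a: "a \<in> carrier A"
  shows "rad A +>\<^bsub>A\<^esub> a = fibre (h a)"
proof (intro equalityI subsetI)
  fix x assume "x \<in> rad A +>\<^bsub>A\<^esub> a"
  then show "x \<in> fibre (h a)"
    using a by (auto simp: a_r_coset_def' rad_eq_kernel fibre_def hom_add_kernel)
next
  fix x assume "x \<in> fibre (h a)"
  then have x: "x \<in> carrier A" "h x = h a" by (simp_all add: fibre_def)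
  have "h (x \<oplus> \<ominus> a) = h (a \<oplus> \<ominus> a)" using x a by (simp add: hom_simps(2) del: M.r_neg)
  then have "x \<oplus> \<ominus> a \<in> rad A" using x a by (simp add: rad_eq_kernel hom_zero M.r_neg)
  moreover have "x = (x \<oplus> \<ominus> a) \<oplus> a" using x a by (simp add: M.a_assoc M.l_neg)
  ultimately show "x \<in> rad A +>\<^bsub>A\<^esub> a" by (auto simp: a_r_coset_def')
qed

lemma quotient_sel:
  "carrier (quot_algebra A (rad A)) = fibre ` carrier T"
  "\<one>\<^bsub>quot_algebra A (rad A)\<^esub> = fibre \<one>\<^bsub>T\<^esub>"
proof -
  show "carrier (quot_algebra A (rad A)) = fibre ` carrier T"
    using coset_eq_fibre surj[symmetric]
    by (auto simp: quot_algebra_def ring.defs FactRing_def A_RCOSETS_def')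
  show "\<one>\<^bsub>quot_algebra A (rad A)\<^esub> = fibre \<one>\<^bsub>T\<^esub>"
    using coset_eq_fibre[OF one_in_carrier]
    by (simp add: quot_algebra_def ring.defs FactRing_def hom_simps)
qed

lemma quotient_mult:
  assumes "t \<in> carrier T" "t' \<in> carrier T"
  shows "fibre t \<otimes>\<^bsub>quot_algebra A (rad A)\<^esub> fibre t' = fibre (t \<otimes>\<^bsub>T\<^esub> t')"
proof -
  have "fibre t \<otimes>\<^bsub>quot_algebra A (rad A)\<^esub> fibre t' = (\<Union>a\<in>fibre t. \<Union>b\<in>fibre t'. rad A +>\<^bsub>A\<^esub> (a \<otimes> b))"
    by (simp add: quot_algebra_def ring.defs FactRing_def rcoset_mult_def)
  also have "\<dots> = (\<Union>a\<in>fibre t. \<Union>b\<in>fibre t'. fibre (t \<otimes>\<^bsub>T\<^esub> t'))"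
    by (intro SUP_cong refl) (auto simp: fibre_def[of t] fibre_def[of t'] coset_eq_fibre mult_closed hom_simps)
  also have "\<dots> = fibre (t \<otimes>\<^bsub>T\<^esub> t')"
    using assms fibre_nonempty by simp
  finally show ?thesis .
qed

lemma quotient_smult:
  assumes "t \<in> carrier T"
  shows "c \<odot>\<^bsub>quot_algebra A (rad A)\<^esub> fibre t = fibre (c \<odot>\<^bsub>T\<^esub> t)"
proof -
  have "c \<odot>\<^bsub>quot_algebra A (rad A)\<^esub> fibre t = (\<Union>a\<in>fibre t. rad A +>\<^bsub>A\<^esub> (c \<odot>\<^bsub>A\<^esub> a))"
    by (simp add: quot_algebra_def ring.defs)
  also have "\<dots> = (\<Union>a\<in>fibre t. fibre (c \<odot>\<^bsub>T\<^esub> t))"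
    by (intro SUP_cong refl) (auto simp: fibre_def[of t] coset_eq_fibre hom_smult)
  also have "\<dots> = fibre (c \<odot>\<^bsub>T\<^esub> t)"
    using assms fibre_nonempty by simp
  finally show ?thesis .
qed

lemma quotient_add:
  assumes "t \<in> carrier T" "t' \<in> carrier T"
  shows "fibre t \<oplus>\<^bsub>quot_algebra A (rad A)\<^esub> fibre t' = fibre (t \<oplus>\<^bsub>T\<^esub> t')"
proof -
  have "fibre t \<oplus>\<^bsub>quot_algebra A (rad A)\<^esub> fibre t' = fibre t <+>\<^bsub>A\<^esub> fibre t'"
    by (simp add: quot_algebra_def ring.defs FactRing_def)
  also have "\<dots> = fibre (t \<oplus>\<^bsub>T\<^esub> t')"
  proof (intro equalityI subsetI)
    fix x assume "x \<in> fibre t <+>\<^bsub>A\<^esub> fibre t'"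
    then show "x \<in> fibre (t \<oplus>\<^bsub>T\<^esub> t')"
      by (auto simp: set_add_def' fibre_def hom_simps)
  next
    fix x assume x: "x \<in> fibre (t \<oplus>\<^bsub>T\<^esub> t')"
    obtain a where a: "a \<in> carrier A" "t = h a" using preimage[OF assms(1)] .
    obtain b where b: "b \<in> carrier A" "t' = h b" using preimage[OF assms(2)] .
    have "x \<in> rad A +>\<^bsub>A\<^esub> (a \<oplus> b)"
      using x a b by (simp add: coset_eq_fibre hom_simps)
    then obtain k where k: "k \<in> carrier A" "h k = \<zero>\<^bsub>T\<^esub>" "x = k \<oplus> (a \<oplus> b)"
      by (auto simp: a_r_coset_def' rad_eq_kernel)
    have "x = a \<oplus> (k \<oplus> b)" using k a b by (simp add: M.a_lcomm)
    moreover have "k \<oplus> b \<in> fibre t'" "a \<in> fibre t"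
      using k a b by (simp_all add: fibre_def hom_add_kernel)
    ultimately show "x \<in> fibre t <+>\<^bsub>A\<^esub> fibre t'" by (auto simp: set_add_def')
  qed
  finally show ?thesis .
qed

lemma quotient_isomorphic:
  shows "T \<cong>\<^sub>J quot_algebra A (rad A)" and "quot_algebra A (rad A) \<cong>\<^sub>J T"
proof -
  have "inj_on fibre (carrier T)"
  proof (rule inj_onI)
    fix t t' assume "t \<in> carrier T" "fibre t = fibre t'"
    then obtain x where "x \<in> fibre t" "x \<in> fibre t'" using fibre_nonempty by blast
    then show "t = t'" by (simp add: fibre_def)
  qed
  then have bij: "bij_betw fibre (carrier T) (carrier (quot_algebra A (rad A)))"
    by (simp add: bij_betw_def quotient_sel)
  have "fibre \<in> Ring.ring_hom T (quot_algebra A (rad A))"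
    by (rule ring_hom_memI) (auto simp: quotient_sel quotient_mult quotient_add)
  then show TQ: "T \<cong>\<^sub>J quot_algebra A (rad A)"
    using bij quotient_smult by (intro alg_isomorphicI) auto
  have closed: "h x \<in> carrier T" if "x \<in> carrier A" for x
    using that surj by blast
  show "quot_algebra A (rad A) \<cong>\<^sub>J T"
  proof (rule alg_isomorphic_sym[OF TQ])
    show "\<one>\<^bsub>T\<^esub> \<in> carrier T" using closed[OF one_in_carrier] by (simp add: hom_simps)
    fix t u c assume t: "t \<in> carrier T"
    obtain x where x: "x \<in> carrier A" "t = h x" using preimage[OF t] .
    show "c \<odot>\<^bsub>T\<^esub> t \<in> carrier T"
      using closed[of "c \<odot>\<^bsub>A\<^esub> x"] x by (simp add: hom_smult)
    assume u: "u \<in> carrier T"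
    obtain y where y: "y \<in> carrier A" "u = h y" using preimage[OF u] .
    show "t \<otimes>\<^bsub>T\<^esub> u \<in> carrier T" "t \<oplus>\<^bsub>T\<^esub> u \<in> carrier T"
      using closed[of "x \<otimes> y"] closed[of "x \<oplus> y"] x y by (simp_all add: hom_simps mult_closed)
  qed
qed

end

text \<open>
  The hypotheses can be verified on any isomorphic copy \<open>B\<close> of \<open>A\<close>: nilpotency pulls back along an
  isomorphism.
\<close>

lemma radical_quotient:
  assumes A: "jordan_algebra A" and iso: "A \<cong>\<^sub>J B"
    and zero_B: "\<And>v. v \<in> carrier B \<Longrightarrow> 0 \<odot>\<^bsub>B\<^esub> v = \<zero>\<^bsub>B\<^esub>"
    and zero_T: "\<And>t. t \<in> carrier T \<Longrightarrow> 0 \<odot>\<^bsub>T\<^esub> t = \<zero>\<^bsub>T\<^esub>"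
    and hom: "\<pi> \<in> Ring.ring_hom B T" and surj: "\<pi> ` carrier B = carrier T"
    and smult: "\<And>c v. v \<in> carrier B \<Longrightarrow> \<pi> (c \<odot>\<^bsub>B\<^esub> v) = c \<odot>\<^bsub>T\<^esub> \<pi> v"
    and nil: "\<And>v. \<lbrakk>v \<in> carrier B; \<pi> v = \<zero>\<^bsub>T\<^esub>\<rbrakk> \<Longrightarrow> nilpotent B v"
    and rad: "rad T \<subseteq> {\<zero>\<^bsub>T\<^esub>}"
  shows "T \<cong>\<^sub>J quot_algebra A (rad A) \<and> quot_algebra A (rad A) \<cong>\<^sub>J T"
proof -
  interpret jordan_algebra A by (rule A)
  obtain g where g: "g \<in> Ring.ring_hom A B" "bij_betw g (carrier A) (carrier B)"
    and gs: "\<And>c x. x \<in> carrier A \<Longrightarrow> g (c \<odot>\<^bsub>A\<^esub> x) = c \<odot>\<^bsub>B\<^esub> g x"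
    using iso by (auto simp: alg_isomorphic_def ring_iso_def)
  have gB: "g x \<in> carrier B" if "x \<in> carrier A" for x using g(2) that by (rule bij_betw_apply)
  have g0: "g \<zero>\<^bsub>A\<^esub> = \<zero>\<^bsub>B\<^esub>" using gs[of "\<zero>\<^bsub>A\<^esub>" 0] gB by (simp add: zero_smult zero_B)
  have p0: "\<pi> \<zero>\<^bsub>B\<^esub> = \<zero>\<^bsub>T\<^esub>"
  proof -
    have "g \<one>\<^bsub>A\<^esub> \<in> carrier B" using gB one_in_carrier by simp
    moreover from this have "\<pi> (g \<one>\<^bsub>A\<^esub>) \<in> carrier T" using surj by blast
    ultimately show ?thesis using smult[of "g \<one>\<^bsub>A\<^esub>" 0] by (simp add: zero_B zero_T)
  qed
  interpret radical_epimorphism A T "\<pi> \<circ> g"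
  proof
    show "\<pi> \<circ> g \<in> Ring.ring_hom A T" using g(1) hom by (rule ring_hom_trans)
    show "(\<pi> \<circ> g) ` carrier A = carrier T"
      unfolding image_comp[symmetric] bij_betw_imp_surj_on[OF g(2)] by (rule surj)
    show "(\<pi> \<circ> g) \<zero>\<^bsub>A\<^esub> = \<zero>\<^bsub>T\<^esub>" by (simp add: g0 p0)
    show "(\<pi> \<circ> g) (c \<odot>\<^bsub>A\<^esub> x) = c \<odot>\<^bsub>T\<^esub> (\<pi> \<circ> g) x" if "x \<in> carrier A" for c x
      using that by (simp add: gs gB smult)
    show "nilpotent A x" if x: "x \<in> carrier A" "(\<pi> \<circ> g) x = \<zero>\<^bsub>T\<^esub>" for x
    proof -
      obtain n :: nat where n: "n > 0" "g x [^]\<^bsub>B\<^esub> n = \<zero>\<^bsub>B\<^esub>"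
        using nil[OF gB[OF x(1)]] x(2) by (auto simp: nilpotent_def)
      then have "g (x [^]\<^bsub>A\<^esub> n) = g \<zero>\<^bsub>A\<^esub>" using ring_hom_nat_pow[OF g(1) x(1)] g0 by simp
      then have "x [^]\<^bsub>A\<^esub> n = \<zero>\<^bsub>A\<^esub>"
        using g(2) nat_pow_carrier[OF x(1)] by (auto simp: bij_betw_def inj_on_def)
      then show ?thesis using n(1) by (auto simp: nilpotent_def)
    qed
  qed (rule rad)
  show ?thesis using quotient_isomorphic by simp
qed

section \<open>Radicals and idempotents of the target algebras\<close>

lemma complex_algebra_sel [simp]:
  "carrier complex_algebra = UNIV" "x \<otimes>\<^bsub>complex_algebra\<^esub> y = x * y" "\<one>\<^bsub>complex_algebra\<^esub> = 1"
  "\<zero>\<^bsub>complex_algebra\<^esub> = 0" "x \<oplus>\<^bsub>complex_algebra\<^esub> y = x + y" "c \<odot>\<^bsub>complex_algebra\<^esub> x = c * x"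
  by (simp_all add: complex_algebra_def)

lemma prod_algebra_sel [simp]:
  "carrier (A \<times>\<^sub>J B) = carrier A \<times> carrier B"
  "(a, b) \<otimes>\<^bsub>A \<times>\<^sub>J B\<^esub> (a', b') = (a \<otimes>\<^bsub>A\<^esub> a', b \<otimes>\<^bsub>B\<^esub> b')"
  "\<one>\<^bsub>A \<times>\<^sub>J B\<^esub> = (\<one>\<^bsub>A\<^esub>, \<one>\<^bsub>B\<^esub>)" "\<zero>\<^bsub>A \<times>\<^sub>J B\<^esub> = (\<zero>\<^bsub>A\<^esub>, \<zero>\<^bsub>B\<^esub>)"
  "(a, b) \<oplus>\<^bsub>A \<times>\<^sub>J B\<^esub> (a', b') = (a \<oplus>\<^bsub>A\<^esub> a', b \<oplus>\<^bsub>B\<^esub> b')"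
  "c \<odot>\<^bsub>A \<times>\<^sub>J B\<^esub> (a, b) = (c \<odot>\<^bsub>A\<^esub> a, c \<odot>\<^bsub>B\<^esub> b)"
  by (simp_all add: prod_algebra_def)

lemma spin_factor_sel [simp]:
  "carrier (spin_factor d) = UNIV \<times> carrier_vec d"
  "(l, a) \<otimes>\<^bsub>spin_factor d\<^esub> (m, b) = (l * m + a \<bullet> b, l \<cdot>\<^sub>v b + m \<cdot>\<^sub>v a)"
  "\<one>\<^bsub>spin_factor d\<^esub> = (1, 0\<^sub>v d)" "\<zero>\<^bsub>spin_factor d\<^esub> = (0, 0\<^sub>v d)"
  "(l, a) \<oplus>\<^bsub>spin_factor d\<^esub> (m, b) = (l + m, a + b)"
  "c \<odot>\<^bsub>spin_factor d\<^esub> (l, a) = (c * l, c \<cdot>\<^sub>v a)"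
  by (simp_all add: spin_factor_def)

lemma rad_complex_algebra: "rad complex_algebra \<subseteq> {\<zero>\<^bsub>complex_algebra\<^esub>}"
proof
  fix x assume "x \<in> rad complex_algebra"
  then have "\<forall>y. nilpotent complex_algebra (x * y)" by (simp add: rad_def)
  then have "nilpotent complex_algebra (x * 1)" by blast
  moreover have "y [^]\<^bsub>complex_algebra\<^esub> n = y ^ n" for y and n :: nat
    by (induction n) simp_all
  ultimately show "x \<in> {\<zero>\<^bsub>complex_algebra\<^esub>}" by (auto simp: nilpotent_def)
qed

lemma rad_prod_algebra:
  assumes "rad A \<subseteq> {\<zero>\<^bsub>A\<^esub>}" "rad B \<subseteq> {\<zero>\<^bsub>B\<^esub>}" and "carrier A \<noteq> {}" "carrier B \<noteq> {}"
  shows "rad (A \<times>\<^sub>J B) \<subseteq> {\<zero>\<^bsub>A \<times>\<^sub>J B\<^esub>}"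
proof
  fix z assume z: "z \<in> rad (A \<times>\<^sub>J B)"
  obtain x y where xy: "z = (x, y)" by (cases z)
  have car: "x \<in> carrier A" "y \<in> carrier B" using z by (auto simp: rad_def xy)
  have pow: "(a, b) [^]\<^bsub>A \<times>\<^sub>J B\<^esub> n = (a [^]\<^bsub>A\<^esub> n, b [^]\<^bsub>B\<^esub> n)" for a b and n :: nat
    by (induction n) simp_all
  have nil: "nilpotent A (x \<otimes>\<^bsub>A\<^esub> a) \<and> nilpotent B (y \<otimes>\<^bsub>B\<^esub> b)" if "a \<in> carrier A" "b \<in> carrier B" for a b
  proof -
    have "nilpotent (A \<times>\<^sub>J B) (z \<otimes>\<^bsub>A \<times>\<^sub>J B\<^esub> (a, b))" using z that by (simp add: rad_def)
    then show ?thesis by (auto simp: nilpotent_def xy pow)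
  qed
  have "x \<in> rad A" "y \<in> rad B" using nil car assms(3,4) unfolding rad_def by blast+
  then show "z \<in> {\<zero>\<^bsub>A \<times>\<^sub>J B\<^esub>}" using assms(1,2) by (auto simp: xy)
qed

text \<open>
  Choose \<open>s\<close> with \<open>s\<^sup>2 = a \<bullet> a\<close>. On the span of \<open>\<one>\<close> and \<open>(0, a)\<close> the maps \<open>(u, k a) \<mapsto> u + k s\<close> and
  \<open>(u, k a) \<mapsto> u - k s\<close> are multiplicative. They take a nilpotent element to \<open>0\<close>, so \<open>m + s = m - s = 0\<close>.
\<close>

lemma nilpotent_spin_factor:
  assumes a: "a \<in> carrier_vec d" and nil: "nilpotent (spin_factor d) (m, a)"
  shows "m = 0"
proof -
  define s where "s = csqrt (a \<bullet> a)"
  have s: "s * s = a \<bullet> a" unfolding s_def by (metis power2_csqrt power2_eq_square)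
  have powers: "\<exists>u k. (m, a) [^]\<^bsub>spin_factor d\<^esub> n = (u, k \<cdot>\<^sub>v a) \<and> u + k * s = (m + s) ^ n \<and> u - k * s = (m - s) ^ n" for n :: nat
  proof (induction n)
    case 0
    have "0\<^sub>v d = 0 \<cdot>\<^sub>v a" using a by auto
    then show ?case by (intro exI[of _ 1] exI[of _ 0]) simp
  next
    case (Suc n)
    then obtain u k where uk: "(m, a) [^]\<^bsub>spin_factor d\<^esub> n = (u, k \<cdot>\<^sub>v a)"
      "u + k * s = (m + s) ^ n" "u - k * s = (m - s) ^ n" by blast
    have "(m, a) [^]\<^bsub>spin_factor d\<^esub> Suc n = (u * m + k * (s * s), (u + m * k) \<cdot>\<^sub>v a)"
      using a by (simp add: uk s smult_smult_assoc add_smult_distrib_vec)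
    moreover have "u * m + k * (s * s) + (u + m * k) * s = (u + k * s) * (m + s)"
      "u * m + k * (s * s) - (u + m * k) * s = (u - k * s) * (m - s)" by (simp_all add: algebra_simps)
    ultimately show ?case
      by (intro exI[of _ "u * m + k * (s * s)"] exI[of _ "u + m * k"]) (simp add: uk)
  qed
  obtain n :: nat where "n > 0" and z: "(m, a) [^]\<^bsub>spin_factor d\<^esub> n = (0, 0\<^sub>v d)"
    using nil by (auto simp: nilpotent_def)
  obtain k where k: "k \<cdot>\<^sub>v a = 0\<^sub>v d" "k * s = (m + s) ^ n" "- (k * s) = (m - s) ^ n"
    using powers[of n] z by auto
  \<comment> \<open>From \<open>k a = 0\<close> alone neither factor need vanish when \<open>a\<close> is isotropic, so \<open>k s\<close> is squared.\<close>
  have "k * s * (k * s) = (k \<cdot>\<^sub>v a) \<bullet> (k \<cdot>\<^sub>v a)" using a s by (simp add: algebra_simps)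
  then have "k * s = 0" by (simp add: k)
  with k(2,3) have "m + s = 0" "m - s = 0" using \<open>n > 0\<close> by auto
  then have "(m + s) + (m - s) = 0" by simp
  then show ?thesis by simp
qed

text \<open>
  The first component of every product with a radical element vanishes. Products with \<open>\<one>\<close> and with the
  unit vectors recover all its coordinates.
\<close>

lemma rad_spin_factor: "rad (spin_factor d) \<subseteq> {\<zero>\<^bsub>spin_factor d\<^esub>}"
proof
  fix z assume z: "z \<in> rad (spin_factor d)"
  obtain l a where la: "z = (l, a)" by (cases z)
  have a: "a \<in> carrier_vec d" using z by (simp add: rad_def la)
  have nil: "nilpotent (spin_factor d) ((l, a) \<otimes>\<^bsub>spin_factor d\<^esub> (m, b))" if "b \<in> carrier_vec d" for m b
    using z that by (simp add: rad_def la)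
  have fst0: "l * m + a \<bullet> b = 0" if b: "b \<in> carrier_vec d" for m b
  proof (rule nilpotent_spin_factor)
    show "l \<cdot>\<^sub>v b + m \<cdot>\<^sub>v a \<in> carrier_vec d" using a b by simp
    show "nilpotent (spin_factor d) (l * m + a \<bullet> b, l \<cdot>\<^sub>v b + m \<cdot>\<^sub>v a)" using nil[OF b] by simp
  qed
  have "l = 0" using fst0[of "0\<^sub>v d" 1] a by simp
  moreover have "a = 0\<^sub>v d"
  proof (rule eq_vecI)
    fix i assume "i < dim_vec (0\<^sub>v d)"
    then have i: "i < d" by simp
    show "a $ i = 0\<^sub>v d $ i"
      using fst0[of "unit_vec d i" 0] a i by simp
  qed (use a in auto)
  ultimately show "z \<in> {\<zero>\<^bsub>spin_factor d\<^esub>}" by (simp add: la)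
qed

definition idempotents :: "(complex, 'a) module \<Rightarrow> 'a set" where
  "idempotents A = {e \<in> carrier A. e \<otimes>\<^bsub>A\<^esub> e = e}"

text \<open>
  Since the cardinality of an infinite set is \<open>0\<close> by convention, this also separates an algebra with
  infinitely many idempotents from one with a positive finite number of them.
\<close>

lemma card_idempotents_isomorphic:
  assumes iso: "A \<cong>\<^sub>J B" and closed: "\<And>x. x \<in> carrier A \<Longrightarrow> x \<otimes>\<^bsub>A\<^esub> x \<in> carrier A"
  shows "card (idempotents A) = card (idempotents B)"
proof -
  obtain h where h: "h \<in> Ring.ring_hom A B" "bij_betw h (carrier A) (carrier B)"
    using iso by (auto simp: alg_isomorphic_def ring_iso_def)
  have inj: "inj_on h (carrier A)" and img: "h ` carrier A = carrier B"
    using h(2) by (auto simp: bij_betw_def)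
  have iff: "h x \<otimes>\<^bsub>B\<^esub> h x = h x \<longleftrightarrow> x \<otimes>\<^bsub>A\<^esub> x = x" if "x \<in> carrier A" for x
    using ring_hom_mult[OF h(1) that that] inj_on_eq_iff[OF inj closed[OF that] that] by simp
  have "h ` idempotents A = idempotents B"
    unfolding idempotents_def img[symmetric] using iff by auto
  moreover have "inj_on h (idempotents A)"
    using inj by (rule inj_on_subset) (auto simp: idempotents_def)
  ultimately show ?thesis by (metis card_image)
qed

lemma idempotents_complex: "idempotents complex_algebra = {0, 1}"
  by (auto simp: idempotents_def)

lemma idempotents_prod: "idempotents (A \<times>\<^sub>J B) = idempotents A \<times> idempotents B"
  by (auto simp: idempotents_def)

lemma spin_factor_idempotent:
  assumes "a \<in> carrier_vec d" "a \<bullet> a = 1 / 4"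
  shows "(1 / 2, a) \<in> idempotents (spin_factor d)"
proof -
  have "1 / 2 * (1 / 2) + a \<bullet> a = 1 / 2" by (simp add: assms(2))
  moreover have "(1 / 2) \<cdot>\<^sub>v a + (1 / 2) \<cdot>\<^sub>v a = a" by (simp flip: add_smult_distrib_vec)
  ultimately show ?thesis using assms(1) by (simp only: idempotents_def) simp
qed

text \<open>
  The pairs \<open>(1/2, a)\<close> with \<open>a \<bullet> a = 1/4\<close> are idempotent, and this conic has infinitely many points.
\<close>

lemma card_idempotents_spin_factor: "card (idempotents (spin_factor 2)) = 0"
proof -
  let ?e = "\<lambda>x. (1 / 2, vec_of_list [x, csqrt (1 / 4 - x\<^sup>2)]) :: complex \<times> complex vec"
  have inj: "inj ?e"
  proof (rule injI)
    fix x y :: complex assume "?e x = ?e y"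
    then have "vec_of_list [x, csqrt (1 / 4 - x\<^sup>2)] $ 0 = vec_of_list [y, csqrt (1 / 4 - y\<^sup>2)] $ 0"
      by simp
    then show "x = y" by simp
  qed
  have "?e x \<in> idempotents (spin_factor 2)" for x
  proof -
    let ?a = "vec_of_list [x, csqrt (1 / 4 - x\<^sup>2)]"
    have car: "?a \<in> carrier_vec 2" by (simp add: carrier_vecI)
    have "?a \<bullet> ?a = x\<^sup>2 + (csqrt (1 / 4 - x\<^sup>2))\<^sup>2"
      by (simp add: scalar_prod_def numeral_2_eq_2 power2_eq_square)
    then show ?thesis using spin_factor_idempotent[OF car] by simp
  qed
  then have "range ?e \<subseteq> idempotents (spin_factor 2)" by blast
  moreover have "infinite (range ?e)"
    using inj finite_imageD infinite_UNIV_char_0 by blast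
  ultimately have "infinite (idempotents (spin_factor 2))" using finite_subset by blast
  then show ?thesis by simp
qed

text \<open>
  Here \<open>X\<close>, \<open>Y\<close> and \<open>U - X - Y\<close> are the three orthogonal idempotents; the coordinates are the values on
  the corresponding factors.
\<close>

lemma algebra_1a_isomorphic:
  "algebra_1a \<cong>\<^sub>J complex_algebra \<times>\<^sub>J complex_algebra \<times>\<^sub>J complex_algebra"
proof (rule alg_isomorphicI)
  let ?h = "\<lambda>v :: complex vec. (v $ 0 + v $ 1, v $ 0 + v $ 2, v $ 0)"
  let ?T = "complex_algebra \<times>\<^sub>J complex_algebra \<times>\<^sub>J complex_algebra"
  show "?h \<in> Ring.ring_hom algebra_1a ?T"
    by (rule ring_hom_memI)
      (auto simp: algebra_1a_def UXY_mult_index algebra_simps simp del: One_nat_def)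
  show "bij_betw ?h (carrier algebra_1a) (carrier ?T)"
  proof (rule bij_betwI[where g = "\<lambda>(a, b, c). vec_of_list [c, a - c, b - c]"])
    have car: "vec_of_list [x, y, z] \<in> carrier_vec 3" for x y z :: complex
      by (simp add: carrier_vecI)
    show "?h \<in> carrier algebra_1a \<rightarrow> carrier ?T" by simp
    show "(\<lambda>(a, b, c). vec_of_list [c, a - c, b - c]) \<in> carrier ?T \<rightarrow> carrier algebra_1a"
      using car by (auto simp: algebra_1a_def)
    show "(\<lambda>(a, b, c). vec_of_list [c, a - c, b - c]) (?h v) = v" if "v \<in> carrier algebra_1a" for v
      using that car[of "v $ 0" "v $ 1" "v $ 2"]
      by (simp add: algebra_1a_def) (rule vec3_eqI, simp_all add: numeral_2_eq_2)
    show "?h ((\<lambda>(a, b, c). vec_of_list [c, a - c, b - c]) w) = w" for w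
      by (cases w) (simp add: numeral_2_eq_2)
  qed
  show "?h (c \<odot>\<^bsub>algebra_1a\<^esub> v) = c \<odot>\<^bsub>?T\<^esub> ?h v" if "v \<in> carrier algebra_1a" for c v
    using that by (simp add: algebra_1a_def algebra_simps)
qed

lemma algebra_1b_isomorphic: "algebra_1b \<cong>\<^sub>J spin_factor 2"
proof (rule alg_isomorphicI)
  let ?h = "\<lambda>v :: complex vec. (v $ 0, vec_of_list [v $ 1, v $ 2])"
  have vec2_eqI: "v = w" if "v \<in> carrier_vec 2" "w \<in> carrier_vec 2" "v $ 0 = w $ 0" "v $ 1 = w $ 1"
    for v w :: "complex vec"
    using that by (intro eq_vecI) (auto simp: less_Suc_eq numeral_2_eq_2)
  have car: "vec_of_list [x, y] \<in> carrier_vec 2" for x y :: complex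
    by (simp add: carrier_vecI)
  have index: "vec_of_list [x, y] $ 1 = y" for x y :: complex
    by simp
  have scalar: "vec_of_list [x, y] \<bullet> vec_of_list [x', y'] = x * x' + y * y'" for x y x' y' :: complex
    by (simp add: scalar_prod_def numeral_2_eq_2)
  show "?h \<in> Ring.ring_hom algebra_1b (spin_factor 2)"
    by (rule ring_hom_memI)
      (use car index scalar in \<open>auto simp: algebra_1b_def UXY_mult_index algebra_simps
        intro!: vec2_eqI simp del: One_nat_def\<close>)
  show "bij_betw ?h (carrier algebra_1b) (carrier (spin_factor 2))"
  proof (rule bij_betwI[where g = "\<lambda>(l, a). vec_of_list [l, a $ 0, a $ 1]"])
    have car3: "vec_of_list [x, y, z] \<in> carrier_vec 3" for x y z :: complex
      by (simp add: carrier_vecI)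
    show "?h \<in> carrier algebra_1b \<rightarrow> carrier (spin_factor 2)"
      using car by auto
    show "(\<lambda>(l, a). vec_of_list [l, a $ 0, a $ 1]) \<in> carrier (spin_factor 2) \<rightarrow> carrier algebra_1b"
      using car3 by (auto simp: algebra_1b_def)
    show "(\<lambda>(l, a). vec_of_list [l, a $ 0, a $ 1]) (?h v) = v" if "v \<in> carrier algebra_1b" for v
      using that car3[of "v $ 0" "v $ 1" "v $ 2"]
      by (simp add: algebra_1b_def) (rule vec3_eqI, simp_all add: numeral_2_eq_2)
    show "?h ((\<lambda>(l, a). vec_of_list [l, a $ 0, a $ 1]) w) = w" if "w \<in> carrier (spin_factor 2)" for w
    proof -
      obtain l a where w: "w = (l, a)" by (cases w)
      have "vec_of_list [a $ 0, a $ 1] = a"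
        using that car[of "a $ 0" "a $ 1"] by (intro vec2_eqI) (simp_all add: w)
      then show ?thesis by (simp add: w numeral_2_eq_2)
    qed
  qed
  show "?h (c \<odot>\<^bsub>algebra_1b\<^esub> v) = c \<odot>\<^bsub>spin_factor 2\<^esub> ?h v" if "v \<in> carrier algebra_1b" for c v
    using that car by (auto simp: algebra_1b_def intro!: vec2_eqI)
qed

text \<open>
  An algebra with zero radical is its own quotient.
\<close>

lemma radical_quotient_trivial:
  assumes A: "jordan_algebra A" and iso: "A \<cong>\<^sub>J T"
    and zero_T: "\<And>t. t \<in> carrier T \<Longrightarrow> 0 \<odot>\<^bsub>T\<^esub> t = \<zero>\<^bsub>T\<^esub>"
    and one_T: "\<one>\<^bsub>T\<^esub> \<otimes>\<^bsub>T\<^esub> \<zero>\<^bsub>T\<^esub> = \<zero>\<^bsub>T\<^esub>"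
    and rad: "rad T \<subseteq> {\<zero>\<^bsub>T\<^esub>}"
  shows "T \<cong>\<^sub>J quot_algebra A (rad A) \<and> quot_algebra A (rad A) \<cong>\<^sub>J T"
proof (rule radical_quotient[OF A iso zero_T zero_T _ _ _ _ rad])
  show "id \<in> Ring.ring_hom T T" by (auto intro: ring_hom_memI)
  show "nilpotent T v" if "id v = \<zero>\<^bsub>T\<^esub>" for v
    using that one_T by (auto simp: nilpotent_def intro!: exI[of _ "1::nat"])
qed simp_all

lemma nilpotent_cube:
  "\<lbrakk>\<one>\<^bsub>A\<^esub> \<otimes>\<^bsub>A\<^esub> x = x; x \<otimes>\<^bsub>A\<^esub> x \<otimes>\<^bsub>A\<^esub> x = \<zero>\<^bsub>A\<^esub>\<rbrakk> \<Longrightarrow> nilpotent A x"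
  unfolding nilpotent_def by (intro exI[of _ "Suc (Suc (Suc 0))"]) simp

lemma UXY_one_mult:
  assumes "p \<in> carrier_vec 3" "q \<in> carrier_vec 3" "r \<in> carrier_vec 3" "v \<in> carrier_vec 3"
  shows "U_vec \<otimes>\<^bsub>UXY_algebra p q r\<^esub> v = v"
  using assms UXY_algebra_products(5)[of p q r v] by simp

text \<open>
  Both \<open>algebra_2a\<close>, with \<open>k = 0\<close>, and \<open>algebra_2b\<close>, with \<open>k = 1/2\<close>, have the radical \<open>\<complex>Y\<close>, and the product modulo
  \<open>Y\<close> is the same: \<open>X\<close> and \<open>U - X\<close> are orthogonal idempotents.
\<close>

lemma radical_quotient_CC:
  assumes A: "jordan_algebra A" and iso: "A \<cong>\<^sub>J UXY_algebra X_vec (0\<^sub>v 3) (k \<cdot>\<^sub>v Y_vec)"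
  defines "T \<equiv> complex_algebra \<times>\<^sub>J complex_algebra"
  shows "T \<cong>\<^sub>J quot_algebra A (rad A) \<and> quot_algebra A (rad A) \<cong>\<^sub>J T"
proof (rule radical_quotient[OF A iso])
  let ?B = "UXY_algebra X_vec (0\<^sub>v 3) (k \<cdot>\<^sub>v Y_vec)"
  let ?\<pi> = "\<lambda>v :: complex vec. (v $ 0 + v $ 1, v $ 0)"
  show "0 \<odot>\<^bsub>?B\<^esub> v = \<zero>\<^bsub>?B\<^esub>" if "v \<in> carrier ?B" for v
    using that by auto
  show "0 \<odot>\<^bsub>T\<^esub> t = \<zero>\<^bsub>T\<^esub>" for t by (cases t) (simp add: T_def)
  show "?\<pi> \<in> Ring.ring_hom ?B T"
    by (rule ring_hom_memI) (auto simp: T_def UXY_mult_index algebra_simps simp del: One_nat_def)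
  show "?\<pi> ` carrier ?B = carrier T"
  proof -
    have "(a, b) \<in> ?\<pi> ` carrier_vec 3" for a b
      by (rule image_eqI[of _ _ "vec_of_list [b, a - b, 0]"]) (auto simp: carrier_vecI)
    then show ?thesis by (auto simp: T_def)
  qed
  show "?\<pi> (c \<odot>\<^bsub>?B\<^esub> v) = c \<odot>\<^bsub>T\<^esub> ?\<pi> v" if "v \<in> carrier ?B" for c v
    using that by (simp add: T_def algebra_simps)
  show "nilpotent ?B v" if "v \<in> carrier ?B" "?\<pi> v = \<zero>\<^bsub>T\<^esub>" for v
    using that
    by (intro nilpotent_cube) (auto simp: UXY_one_mult T_def UXY_mult_index intro!: vec3_eqI simp del: One_nat_def)
  show "rad T \<subseteq> {\<zero>\<^bsub>T\<^esub>}"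
    unfolding T_def by (intro rad_prod_algebra rad_complex_algebra) auto
qed

text \<open>
  For \<open>k = 1\<close> this is \<open>algebra_3a\<close>, and for \<open>k = 0\<close> it is \<open>algebra_3b\<close>. The span of \<open>X\<close> and \<open>Y\<close> is the kernel of the
  projection to \<open>U\<close>, and every cube in it vanishes.
\<close>

lemma radical_quotient_C:
  assumes A: "jordan_algebra A" and iso: "A \<cong>\<^sub>J UXY_algebra (k \<cdot>\<^sub>v Y_vec) (0\<^sub>v 3) (0\<^sub>v 3)"
  defines "T \<equiv> complex_algebra"
  shows "T \<cong>\<^sub>J quot_algebra A (rad A) \<and> quot_algebra A (rad A) \<cong>\<^sub>J T"
proof (rule radical_quotient[OF A iso])
  let ?B = "UXY_algebra (k \<cdot>\<^sub>v Y_vec) (0\<^sub>v 3) (0\<^sub>v 3)"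
  let ?\<pi> = "\<lambda>v :: complex vec. v $ 0"
  show "0 \<odot>\<^bsub>?B\<^esub> v = \<zero>\<^bsub>?B\<^esub>" if "v \<in> carrier ?B" for v
    using that by auto
  show "0 \<odot>\<^bsub>T\<^esub> t = \<zero>\<^bsub>T\<^esub>" for t by (simp add: T_def)
  show "?\<pi> \<in> Ring.ring_hom ?B T"
    by (rule ring_hom_memI) (auto simp: T_def UXY_mult_index simp del: One_nat_def)
  show "?\<pi> ` carrier ?B = carrier T"
  proof -
    have "a \<in> ?\<pi> ` carrier_vec 3" for a
      by (rule image_eqI[of _ _ "vec_of_list [a, 0, 0]"]) (auto simp: carrier_vecI)
    then show ?thesis by (auto simp: T_def)
  qed
  show "?\<pi> (c \<odot>\<^bsub>?B\<^esub> v) = c \<odot>\<^bsub>T\<^esub> ?\<pi> v" if "v \<in> carrier ?B" for c v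
    using that by (simp add: T_def)
  show "nilpotent ?B v" if "v \<in> carrier ?B" "?\<pi> v = \<zero>\<^bsub>T\<^esub>" for v
    using that
    by (intro nilpotent_cube) (auto simp: UXY_one_mult T_def UXY_mult_index intro!: vec3_eqI simp del: One_nat_def)
qed (simp add: T_def rad_complex_algebra[simplified])

section \<open>The classification\<close>

theorem theorem2p7:
  fixes A :: "(complex, 'a) module"
  assumes "jordan_algebra A"
    and "vectorspace.fin_dim (class_ring :: complex ring) A"
    and "vectorspace.dim (class_ring :: complex ring) A = 3"
  defines "CC \<equiv> complex_algebra \<times>\<^sub>J complex_algebra"
    and "CCC \<equiv> complex_algebra \<times>\<^sub>J complex_algebra \<times>\<^sub>J complex_algebra"
  shows "((A \<cong>\<^sub>J CCC \<and> A \<cong>\<^sub>J algebra_1a)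
        \<or> (A \<cong>\<^sub>J spin_factor 2 \<and> A \<cong>\<^sub>J algebra_1b)
        \<or> (quot_algebra A (rad A) \<cong>\<^sub>J CC \<and> (A \<cong>\<^sub>J algebra_2a \<or> A \<cong>\<^sub>J algebra_2b))
        \<or> (quot_algebra A (rad A) \<cong>\<^sub>J complex_algebra \<and> (A \<cong>\<^sub>J algebra_3a \<or> A \<cong>\<^sub>J algebra_3b)))
      \<and> (A \<cong>\<^sub>J CCC \<longrightarrow> A \<cong>\<^sub>J algebra_1a)
      \<and> (A \<cong>\<^sub>J spin_factor 2 \<longrightarrow> A \<cong>\<^sub>J algebra_1b)
      \<and> (quot_algebra A (rad A) \<cong>\<^sub>J CC \<longrightarrow> A \<cong>\<^sub>J algebra_2a \<or> A \<cong>\<^sub>J algebra_2b)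
      \<and> (quot_algebra A (rad A) \<cong>\<^sub>J complex_algebra \<longrightarrow> A \<cong>\<^sub>J algebra_3a \<or> A \<cong>\<^sub>J algebra_3b)"
proof -
  let ?Q = "quot_algebra A (rad A)"
  note A = assms(1)
  have iso_1a: "algebra_1a \<cong>\<^sub>J CCC" "CCC \<cong>\<^sub>J algebra_1a"
    using algebra_1a_isomorphic UXY_isomorphic_sym[of X_vec Y_vec "0\<^sub>v 3"] by (simp_all add: CCC_def algebra_1a_def)
  have iso_1b: "algebra_1b \<cong>\<^sub>J spin_factor 2" "spin_factor 2 \<cong>\<^sub>J algebra_1b"
    using algebra_1b_isomorphic UXY_isomorphic_sym[of U_vec U_vec "0\<^sub>v 3"] by (simp_all add: algebra_1b_def)
  have "Y_vec = 1 \<cdot>\<^sub>v Y_vec" "0\<^sub>v 3 = 0 \<cdot>\<^sub>v Y_vec" by auto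
  then have alg: "algebra_2a = UXY_algebra X_vec (0\<^sub>v 3) (0 \<cdot>\<^sub>v Y_vec)"
    "algebra_2b = UXY_algebra X_vec (0\<^sub>v 3) ((1 / 2) \<cdot>\<^sub>v Y_vec)"
    "algebra_3a = UXY_algebra (1 \<cdot>\<^sub>v Y_vec) (0\<^sub>v 3) (0\<^sub>v 3)"
    "algebra_3b = UXY_algebra (0 \<cdot>\<^sub>v Y_vec) (0\<^sub>v 3) (0\<^sub>v 3)"
    by (simp_all only: algebra_2a_def algebra_2b_def algebra_3a_def algebra_3b_def)
  have Q1a: "CCC \<cong>\<^sub>J ?Q" if "A \<cong>\<^sub>J algebra_1a"
    using radical_quotient_trivial[OF A alg_isomorphic_trans[OF that iso_1a(1)]]
      rad_prod_algebra[OF rad_complex_algebra rad_prod_algebra[OF rad_complex_algebra rad_complex_algebra]]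
    by (auto simp: CCC_def)
  have Q1b: "spin_factor 2 \<cong>\<^sub>J ?Q" if "A \<cong>\<^sub>J algebra_1b"
  proof -
    have "0 \<cdot>\<^sub>v b = 0\<^sub>v 2" if "b \<in> carrier_vec 2" for b :: "complex vec" using that by auto
    then show ?thesis
      using radical_quotient_trivial[OF A alg_isomorphic_trans[OF that iso_1b(1)]] rad_spin_factor[of 2]
      by auto
  qed
  have Q2: "CC \<cong>\<^sub>J ?Q \<and> ?Q \<cong>\<^sub>J CC" if "A \<cong>\<^sub>J algebra_2a \<or> A \<cong>\<^sub>J algebra_2b"
    using that radical_quotient_CC[OF A] unfolding alg CC_def by blast
  have Q3: "complex_algebra \<cong>\<^sub>J ?Q \<and> ?Q \<cong>\<^sub>J complex_algebra" if "A \<cong>\<^sub>J algebra_3a \<or> A \<cong>\<^sub>J algebra_3b"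
    using that radical_quotient_C[OF A] unfolding alg by blast
  have idem: "card (idempotents complex_algebra) = 2" "card (idempotents CC) = 4" "card (idempotents CCC) = 8"
    by (simp_all add: CC_def CCC_def idempotents_prod idempotents_complex card_cartesian_product)
  have closed: "x \<otimes>\<^bsub>CC\<^esub> x \<in> carrier CC" if "x \<in> carrier CC" for x
    using that by (auto simp: CC_def)
  have closed3: "x \<otimes>\<^bsub>CCC\<^esub> x \<in> carrier CCC" if "x \<in> carrier CCC" for x
    using that by (auto simp: CCC_def)
  have closed_spin: "x \<otimes>\<^bsub>spin_factor 2\<^esub> x \<in> carrier (spin_factor 2)" if "x \<in> carrier (spin_factor 2)" for x
    using that by auto
  have noniso: "\<not> CCC \<cong>\<^sub>J CC" "\<not> CCC \<cong>\<^sub>J complex_algebra"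
    using card_idempotents_isomorphic[OF _ closed3, of CC]
      card_idempotents_isomorphic[OF _ closed3, of complex_algebra] idem by auto
  have noniso_spin: "\<not> spin_factor 2 \<cong>\<^sub>J CC" "\<not> spin_factor 2 \<cong>\<^sub>J complex_algebra"
    using card_idempotents_isomorphic[OF _ closed_spin, of CC]
      card_idempotents_isomorphic[OF _ closed_spin, of complex_algebra] idem card_idempotents_spin_factor
    by auto
  have noniso_CC: "\<not> CC \<cong>\<^sub>J complex_algebra" "\<not> complex_algebra \<cong>\<^sub>J CC"
    using card_idempotents_isomorphic[OF _ closed, of complex_algebra]
      card_idempotents_isomorphic[of complex_algebra CC] idem by auto
  note trans = alg_isomorphic_trans
  have "A \<cong>\<^sub>J algebra_1a \<or> A \<cong>\<^sub>J algebra_1b \<or> A \<cong>\<^sub>J algebra_2a \<or> A \<cong>\<^sub>J algebra_2b \<or>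
    A \<cong>\<^sub>J algebra_3a \<or> A \<cong>\<^sub>J algebra_3b"
    using jordan_algebra.classification[OF A assms(2,3)] .
  then consider "A \<cong>\<^sub>J algebra_1a" | "A \<cong>\<^sub>J algebra_1b" | "A \<cong>\<^sub>J algebra_2a \<or> A \<cong>\<^sub>J algebra_2b"
    | "A \<cong>\<^sub>J algebra_3a \<or> A \<cong>\<^sub>J algebra_3b" by blast
  then have main: "(A \<cong>\<^sub>J CCC \<and> A \<cong>\<^sub>J algebra_1a \<and> \<not> ?Q \<cong>\<^sub>J CC \<and> \<not> ?Q \<cong>\<^sub>J complex_algebra)
        \<or> (A \<cong>\<^sub>J spin_factor 2 \<and> A \<cong>\<^sub>J algebra_1b \<and> \<not> ?Q \<cong>\<^sub>J CC \<and> \<not> ?Q \<cong>\<^sub>J complex_algebra)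
        \<or> (?Q \<cong>\<^sub>J CC \<and> (A \<cong>\<^sub>J algebra_2a \<or> A \<cong>\<^sub>J algebra_2b) \<and> \<not> ?Q \<cong>\<^sub>J complex_algebra)
        \<or> (?Q \<cong>\<^sub>J complex_algebra \<and> (A \<cong>\<^sub>J algebra_3a \<or> A \<cong>\<^sub>J algebra_3b) \<and> \<not> ?Q \<cong>\<^sub>J CC)"
  proof cases
    case 1
    then show ?thesis using trans[OF 1 iso_1a(1)] trans[OF Q1a[OF 1], of CC] trans[OF Q1a[OF 1], of complex_algebra] noniso by blast
  next
    case 2
    then show ?thesis using trans[OF 2 iso_1b(1)] trans[OF Q1b[OF 2], of CC] trans[OF Q1b[OF 2], of complex_algebra] noniso_spin by blast
  next
    case 3
    then show ?thesis using Q2[OF 3] trans[of CC ?Q complex_algebra] noniso_CC(1) by blast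
  next
    case 4
    then show ?thesis using Q3[OF 4] trans[of complex_algebra ?Q CC] noniso_CC(2) by blast
  qed
  have from_1a: "A \<cong>\<^sub>J CCC \<longrightarrow> A \<cong>\<^sub>J algebra_1a"
    and from_1b: "A \<cong>\<^sub>J spin_factor 2 \<longrightarrow> A \<cong>\<^sub>J algebra_1b"
    using trans[OF _ iso_1a(2), of A] trans[OF _ iso_1b(2), of A] by simp_all
  show ?thesis
    using main from_1a from_1b by (elim disjE conjE) simp_all
qed

end
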